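(* Let $(Y,\omega,b)$ be an l.c.p-s. manifold with a splitting $TY=G\oplus E$, $E=T\mathcal F=\ker\omega$, and let $(U,\omega_U,\pi^*b)$, $U\subset E^*$, be its l.c.s. thickening. Let $s:Y\to U$ be a section and let $\nabla s=\Pi^v\circ ds$ be the vertical projection of $ds$. Then the graph of the section $s:Y\to U$ is coisotropic with respect to $\omega_U$ if and only if $s$ satisfies $$\nabla_i s_\alpha\,\widetilde\omega^{ij}\,\nabla_j s_\beta=\nabla_\beta s_\alpha-\nabla_\alpha s_\beta\qquad\text{for all }\alpha>\beta,$$ or $$\tfrac12\big(\nabla_i s_\alpha\,\widetilde\omega^{ij}\,\nabla_j s_\beta\big)f_\alpha^*\wedge f_\beta^*=(\nabla_\beta s_\alpha)\,f_\alpha^*\wedge f_\beta^*,$$ where $\{f_\alpha^*\}$ is the dual frame of $\{\partial/\partial q^1,\dots,\partial/\partial q^{n-k}\}$ given by $f_\beta^*=dq^\beta-R_i^\beta dy^i$.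
   Context: Repeated indices are summed. An l.c.p-s. manifold is a triple $(Y,\omega,b)$ with $b$ a closed one-form and $\omega$ a two-form of constant rank (here $2k$, with $\dim Y=n+k$) such that $d\omega+b\wedge\omega=0$; the distribution $E=\ker\omega$ is integrable and $\mathcal F$ is its (null) foliation. Let $\pi:E^*\to Y$, let $p_G:TY\to E$ be the projection along $G$, and let $\theta_G$ be the one-form on $E^*$ given by $\theta_{G,\widehat\alpha}(\xi)=\widehat\alpha(p_G\circ T\pi(\xi))$. The l.c.s. thickening is a neighborhood $U\subset E^*$ of the zero section on which $\omega_U=\pi^*\omega-d\theta_G-\pi^*b\wedge\theta_G$ is nondegenerate. A submanifold is coisotropic if its tangent spaces contain their $\omega_U$-orthogonals. Foliation coordinates $(y^1,\dots,y^{2k},q^1,\dots,q^{n-k})$ on $Y$ are such that $E=\mathrm{span}\{\partial/\partial q^\alpha\}$; then $G=\mathrm{span}\{\frac{\partial}{\partial y^i}+R_i^\alpha\frac{\partial}{\partial q^\alpha}\}$ for unique functions $R_i^\alpha$. Let $(y^i,q^\alpha,p_\alpha)$ be the induced coordinates on $U$, with $\widehat\alpha=p_\beta f_\beta^*$. Write $b=b_i\,dy^i+b_\gamma\,dq^\gamma$, $\omega_{ij}=\omega(\partial/\partial y^i,\partial/\partial y^j)$, $s=s_\beta f_\beta^*$. Put $$e_j=\frac{\partial}{\partial y^j}+R_j^\alpha\frac{\partial}{\partial q^\alpha}-\Big(p_\nu(b_j+b_\gamma R_j^\gamma)+p_\beta\frac{\partial R_j^\beta}{\partial q^\nu}\Big)\frac{\partial}{\partial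 p_\nu},\qquad f_\alpha=\frac{\partial}{\partial q^\alpha},$$ $G^\sharp=(T\pi^{-1}(\mathcal F))^{\omega_U}=\mathrm{span}\{e_j\}$ and $E^\sharp=\mathrm{span}\{f_\alpha\}$. These give a local splitting $TU=(G^\sharp\oplus E^\sharp)\oplus VTU$, where $VTU$ is the vertical bundle, and $\Pi^v:TU\to VTU$ is the vertical projection with respect to it. The components of $\nabla s=\Pi^v\circ ds$ are given by $\nabla s(\partial/\partial y^i)=(\nabla_i s_\alpha)\,\partial/\partial p_\alpha$ and $\nabla s(\partial/\partial q^\beta)=(\nabla_\beta s_\alpha)\,\partial/\partial p_\alpha$ with $$\nabla_i s_\alpha=\frac{\partial s_\alpha}{\partial y^i}+s_\alpha(b_i+b_\gamma R_i^\gamma)+s_\beta\frac{\partial R_i^\beta}{\partial q^\alpha},\qquad \nabla_\beta s_\alpha=\frac{\partial s_\alpha}{\partial q^\beta}.$$ Finally $$\widetilde\omega_{ij}=\omega_{ij}-s_\beta F^\beta_{ij},\qquad F^\beta_{ij}=\frac{\partial R^\beta_j}{\partial y^i}-\frac{\partial R^\beta_i}{\partial y^j}+R_i^\gamma\frac{\partial R^\beta_j}{\partial q^\gamma}-R_j^\gamma\frac{\partial R^\beta_i}{\partial q^\gamma},$$ and $(\widetilde\omega^{ij})$ is the inverse of $(\widetilde\omega_{ij})$, which is invertible when $s$ is $C^0$-close to the zero section, or its image stays inside $U$.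
   Formalization: The printed local formulas fail; here ∇_i s = ∇s(∂/∂y^i + R_i^α ∂/∂q^α), f_α = ∂/∂q^α − b_α p_ν ∂/∂p_ν (so ∇_β s_α = ∂s_α/∂q^β + b_β s_α), ω̃_ij = ω_ij + s_β F^β_ij, and (ω̃^ij) is the transposed inverse; k ≥ 1 and n−k ≥ 1. *)

theory Defs
  imports "HOL-Analysis.Analysis"
begin

section \<open>Smooth manifolds, tangent vectors and differential forms\<close>

primrec Ck_on :: "nat \<Rightarrow> 'v::real_normed_vector set \<Rightarrow> ('v \<Rightarrow> 'w::real_normed_vector) \<Rightarrow> bool" where
  "Ck_on 0 S f = continuous_on S f"
| "Ck_on (Suc n) S f \<longleftrightarrow> (\<forall>u\<in>S. f differentiable (at u)) \<and>
     (\<forall>e. Ck_on n S (\<lambda>u. frechet_derivative f (at u) e))"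

definition smooth_on :: "'v::real_normed_vector set \<Rightarrow> ('v \<Rightarrow> 'w::real_normed_vector) \<Rightarrow> bool" where
  "smooth_on S f \<longleftrightarrow> (\<forall>n. Ck_on n S f)"

text \<open>A chart is its domain together with its coordinate map; the values of the map off the domain
  are irrelevant.\<close>

type_synonym ('a, 'v) chart = "'a set \<times> ('a \<Rightarrow> 'v)"

abbreviation cdom :: "('a, 'v) chart \<Rightarrow> 'a set" where "cdom c \<equiv> fst c"
abbreviation cmap :: "('a, 'v) chart \<Rightarrow> 'a \<Rightarrow> 'v" where "cmap c \<equiv> snd c"
definition cinv :: "('a, 'v) chart \<Rightarrow> 'v \<Rightarrow> 'a" where "cinv c = inv_into (cdom c) (cmap c)"

definition points :: "('a, 'v) chart set \<Rightarrow> 'a set" where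
  "points A = (\<Union>c\<in>A. cdom c)"

definition smooth_atlas :: "('a, 'v::euclidean_space) chart set \<Rightarrow> bool" where
  "smooth_atlas A \<longleftrightarrow>
     (\<forall>c\<in>A. inj_on (cmap c) (cdom c) \<and> open (cmap c ` cdom c)) \<and>
     (\<forall>c\<in>A. \<forall>c'\<in>A. open (cmap c ` (cdom c \<inter> cdom c')) \<and>
        smooth_on (cmap c ` (cdom c \<inter> cdom c')) (cmap c' \<circ> cinv c))"

definition atlas_topology :: "('a, 'v::euclidean_space) chart set \<Rightarrow> 'a topology" where
  "atlas_topology A =
     topology (\<lambda>W. W \<subseteq> points A \<and> (\<forall>c\<in>A. open (cmap c ` (W \<inter> cdom c))))"

definition smooth_manifold :: "('a, 'v::euclidean_space) chart set \<Rightarrow> bool" where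
  "smooth_manifold A \<longleftrightarrow>
     smooth_atlas A \<and>
     (\<forall>c. cdom c \<subseteq> points A \<and> smooth_atlas (insert c A) \<longrightarrow> c \<in> A) \<and>
     Hausdorff_space (atlas_topology A) \<and> second_countable (atlas_topology A)"

text \<open>A tangent vector at \<open>x\<close> assigns to every chart around \<open>x\<close> a coordinate vector, compatibly with
  the derivatives of the coordinate changes (and \<open>0\<close> to all other charts). Since tangent vectors do
  not remember their base point, the latter is always passed explicitly.\<close>

type_synonym ('a, 'v) tangent = "('a, 'v) chart \<Rightarrow> 'v"
type_synonym ('a, 'v) one_field = "'a \<Rightarrow> ('a, 'v) tangent \<Rightarrow> real"
type_synonym ('a, 'v) two_field = "'a \<Rightarrow> ('a, 'v) tangent \<Rightarrow> ('a, 'v) tangent \<Rightarrow> real"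
type_synonym ('a, 'v) distribution = "'a \<Rightarrow> ('a, 'v) tangent set"

definition tangent_space ::
  "('a, 'v::euclidean_space) chart set \<Rightarrow> 'a \<Rightarrow> ('a, 'v) tangent set" where
  "tangent_space A x =
     {v. (\<forall>c\<in>A. \<forall>c'\<in>A. x \<in> cdom c \<and> x \<in> cdom c' \<longrightarrow>
            v c' = frechet_derivative (cmap c' \<circ> cinv c) (at (cmap c x)) (v c)) \<and>
         (\<forall>c. c \<notin> A \<or> x \<notin> cdom c \<longrightarrow> v c = 0)}"

definition tsubspace :: "('a, 'v::euclidean_space) tangent set \<Rightarrow> bool" where
  "tsubspace V \<longleftrightarrow> (\<lambda>c. 0) \<in> V \<and> (\<forall>v\<in>V. \<forall>w\<in>V. (\<lambda>c. v c + w c) \<in> V) \<and>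
     (\<forall>r. \<forall>v\<in>V. (\<lambda>c. r *\<^sub>R v c) \<in> V)"

definition tlinear ::
  "('a, 'v::euclidean_space) tangent set \<Rightarrow> (('a, 'v) tangent \<Rightarrow> real) \<Rightarrow> bool" where
  "tlinear V f \<longleftrightarrow> (\<forall>v\<in>V. \<forall>w\<in>V. f (\<lambda>c. v c + w c) = f v + f w) \<and>
     (\<forall>r. \<forall>v\<in>V. f (\<lambda>c. r *\<^sub>R v c) = r * f v)"

text \<open>The tangent vector at \<open>x\<close> with coordinate vector \<open>e\<close> in the chart \<open>c\<close>.\<close>

definition coord_vec ::
  "('a, 'v::euclidean_space) chart set \<Rightarrow> ('a, 'v) chart \<Rightarrow> 'a \<Rightarrow> 'v \<Rightarrow> ('a, 'v) tangent" where
  "coord_vec A c x e = (\<lambda>c'. if c' \<in> A \<and> x \<in> cdom c'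
     then frechet_derivative (cmap c' \<circ> cinv c) (at (cmap c x)) e else 0)"

definition chart_at :: "('a, 'v) chart set \<Rightarrow> 'a \<Rightarrow> ('a, 'v) chart" where
  "chart_at A x = (SOME c. c \<in> A \<and> x \<in> cdom c)"

definition differential ::
  "('a, 'v::euclidean_space) chart set \<Rightarrow> ('b, 'w::euclidean_space) chart set \<Rightarrow> ('a \<Rightarrow> 'b) \<Rightarrow> 'a
     \<Rightarrow> ('a, 'v) tangent \<Rightarrow> ('b, 'w) tangent" where
  "differential A B f x v = (\<lambda>d. if d \<in> B \<and> f x \<in> cdom d
     then frechet_derivative (cmap d \<circ> f \<circ> cinv (chart_at A x)) (at (cmap (chart_at A x) x))
            (v (chart_at A x))
     else 0)"

definition smooth_map ::
  "('a, 'v::euclidean_space) chart set \<Rightarrow> ('b, 'w::euclidean_space) chart set \<Rightarrow> ('a \<Rightarrow> 'b)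
     \<Rightarrow> bool" where
  "smooth_map A B f \<longleftrightarrow> f ` points A \<subseteq> points B \<and>
     (\<forall>c\<in>A. \<forall>d\<in>B. open (cmap c ` {x \<in> cdom c. f x \<in> cdom d}) \<and>
        smooth_on (cmap c ` {x \<in> cdom c. f x \<in> cdom d}) (cmap d \<circ> f \<circ> cinv c))"

definition cderiv ::
  "('a, 'v::euclidean_space) chart \<Rightarrow> ('a \<Rightarrow> real) \<Rightarrow> 'a \<Rightarrow> 'v \<Rightarrow> real" where
  "cderiv c g x e = frechet_derivative (g \<circ> cinv c) (at (cmap c x)) e"

definition one_form ::
  "('a, 'v::euclidean_space) chart set \<Rightarrow> ('a, 'v) one_field \<Rightarrow> bool" where
  "one_form A b \<longleftrightarrow>
     (\<forall>x\<in>points A. tlinear (tangent_space A x) (b x)) \<and>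
     (\<forall>c\<in>A. \<forall>e. smooth_on (cmap c ` cdom c)
        (\<lambda>u. b (cinv c u) (coord_vec A c (cinv c u) e)))"

definition two_form ::
  "('a, 'v::euclidean_space) chart set \<Rightarrow> ('a, 'v) two_field
     \<Rightarrow> bool" where
  "two_form A \<omega> \<longleftrightarrow>
     (\<forall>x\<in>points A. \<forall>v\<in>tangent_space A x.
        tlinear (tangent_space A x) (\<omega> x v) \<and>
        (\<forall>w\<in>tangent_space A x. \<omega> x v w = - \<omega> x w v)) \<and>
     (\<forall>c\<in>A. \<forall>e e'. smooth_on (cmap c ` cdom c)
        (\<lambda>u. \<omega> (cinv c u) (coord_vec A c (cinv c u) e) (coord_vec A c (cinv c u) e')))"

text \<open>Exterior derivatives, computed on the constant-coefficient extensions of the arguments in a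
  chart around \<open>x\<close>; for smooth forms the choice of the chart does not matter.\<close>

definition ext_deriv1 ::
  "('a, 'v::euclidean_space) chart set \<Rightarrow> ('a, 'v) one_field
     \<Rightarrow> 'a \<Rightarrow> ('a, 'v) tangent \<Rightarrow> ('a, 'v) tangent \<Rightarrow> real" where
  "ext_deriv1 A b x v w =
     (let c = chart_at A x;
          B = (\<lambda>e y. b y (coord_vec A c y e))
      in cderiv c (B (w c)) x (v c) - cderiv c (B (v c)) x (w c))"

definition ext_deriv2 ::
  "('a, 'v::euclidean_space) chart set \<Rightarrow> ('a, 'v) two_field
     \<Rightarrow> 'a \<Rightarrow> ('a, 'v) tangent \<Rightarrow> ('a, 'v) tangent \<Rightarrow> ('a, 'v) tangent \<Rightarrow> real" where
  "ext_deriv2 A \<omega> x v1 v2 v3 =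
     (let c = chart_at A x;
          W = (\<lambda>e e' y. \<omega> y (coord_vec A c y e) (coord_vec A c y e'))
      in cderiv c (W (v2 c) (v3 c)) x (v1 c) - cderiv c (W (v1 c) (v3 c)) x (v2 c)
         + cderiv c (W (v1 c) (v2 c)) x (v3 c))"

definition wedge11 :: "('t \<Rightarrow> real) \<Rightarrow> ('t \<Rightarrow> real) \<Rightarrow> 't \<Rightarrow> 't \<Rightarrow> real" where
  "wedge11 f g v w = f v * g w - f w * g v"

definition wedge12 :: "('t \<Rightarrow> real) \<Rightarrow> ('t \<Rightarrow> 't \<Rightarrow> real) \<Rightarrow> 't \<Rightarrow> 't \<Rightarrow> 't \<Rightarrow> real" where
  "wedge12 f \<omega> v1 v2 v3 = f v1 * \<omega> v2 v3 - f v2 * \<omega> v1 v3 + f v3 * \<omega> v1 v2"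


section \<open>L.c.p-s. manifolds, splittings and the thickening\<close>

definition ker_form ::
  "('a, 'v::euclidean_space) chart set \<Rightarrow> ('a, 'v) two_field
     \<Rightarrow> 'a \<Rightarrow> ('a, 'v) tangent set" where
  "ker_form A \<omega> x = {v \<in> tangent_space A x. \<forall>w\<in>tangent_space A x. \<omega> x v w = 0}"

text \<open>\<open>\<omega>\<close> has constant rank \<open>2 * k\<close>.\<close>

definition lcps_manifold ::
  "nat \<Rightarrow> ('a, 'v::euclidean_space) chart set
     \<Rightarrow> ('a, 'v) two_field \<Rightarrow> ('a, 'v) one_field
     \<Rightarrow> bool" where
  "lcps_manifold k A \<omega> b \<longleftrightarrow>
     smooth_manifold A \<and> two_form A \<omega> \<and> one_form A b \<and>
     (\<forall>c\<in>A. \<forall>x\<in>cdom c. dim {e. coord_vec A c x e \<in> ker_form A \<omega> x} + 2 * k = DIM('v)) \<and>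
     (\<forall>x\<in>points A. \<forall>v\<in>tangent_space A x. \<forall>w\<in>tangent_space A x. ext_deriv1 A b x v w = 0) \<and>
     (\<forall>x\<in>points A. \<forall>v1\<in>tangent_space A x. \<forall>v2\<in>tangent_space A x. \<forall>v3\<in>tangent_space A x.
        ext_deriv2 A \<omega> x v1 v2 v3 + wedge12 (b x) (\<omega> x) v1 v2 v3 = 0)"

type_synonym ('y, 'q) yq = "(real, 'y) vec \<times> (real, 'q) vec"
type_synonym ('y, 'q) yqp = "('y, 'q) yq \<times> (real, 'q) vec"

text \<open>Foliation coordinates \<open>(y, q)\<close>: the kernel distribution is spanned by the \<open>\<partial>/\<partial>q\<close>.\<close>

definition foliation_charts ::
  "('a, ('y::finite, 'q::finite) yq) chart set \<Rightarrow> ('a, ('y, 'q) yq) two_field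
     \<Rightarrow> ('a, ('y, 'q) yq) chart set" where
  "foliation_charts A \<omega> =
     {c \<in> A. \<forall>x\<in>cdom c. ker_form A \<omega> x = range (\<lambda>t. coord_vec A c x (0, t))}"

text \<open>The null foliation exists, i.e. \<open>ker \<omega>\<close> is integrable. This is automatic for an l.c.p-s.
  manifold by the Frobenius theorem.\<close>

definition null_foliation ::
  "('a, ('y::finite, 'q::finite) yq) chart set \<Rightarrow> ('a, ('y, 'q) yq) two_field \<Rightarrow> bool" where
  "null_foliation A \<omega> \<longleftrightarrow> points A = (\<Union>c\<in>foliation_charts A \<omega>. cdom c)"

text \<open>The projection to \<open>E = ker \<omega>\<close> along \<open>G\<close>.\<close>

definition proj_along ::
  "('a, 'v::euclidean_space) chart set \<Rightarrow> ('a, 'v) two_field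
     \<Rightarrow> ('a, 'v) distribution \<Rightarrow> 'a \<Rightarrow> ('a, 'v) tangent \<Rightarrow> ('a, 'v) tangent" where
  "proj_along A \<omega> G x v = (THE w. w \<in> ker_form A \<omega> x \<and> (\<lambda>c. v c - w c) \<in> G x)"

text \<open>Smoothness of the subbundle \<open>G\<close> is expressed by smoothness of this projection.\<close>

definition splitting ::
  "('a, 'v::euclidean_space) chart set \<Rightarrow> ('a, 'v) two_field
     \<Rightarrow> ('a, 'v) distribution \<Rightarrow> bool" where
  "splitting A \<omega> G \<longleftrightarrow>
     (\<forall>x\<in>points A. tsubspace (G x) \<and> G x \<subseteq> tangent_space A x \<and>
        G x \<inter> ker_form A \<omega> x = {\<lambda>c. 0} \<and>
        (\<forall>v\<in>tangent_space A x. \<exists>w\<in>ker_form A \<omega> x. (\<lambda>c. v c - w c) \<in> G x)) \<and>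
     (\<forall>c\<in>A. \<forall>e. smooth_on (cmap c ` cdom c)
        (\<lambda>u. proj_along A \<omega> G (cinv c u) (coord_vec A c (cinv c u) e) c))"

abbreviation d_y ::
  "('a, ('y::finite, 'q::finite) yq) chart set \<Rightarrow> ('a, ('y, 'q) yq) chart \<Rightarrow> 'a \<Rightarrow> 'y
     \<Rightarrow> ('a, ('y, 'q) yq) tangent" where
  "d_y A c x i \<equiv> coord_vec A c x (axis i 1, 0)"

abbreviation d_q ::
  "('a, ('y::finite, 'q::finite) yq) chart set \<Rightarrow> ('a, ('y, 'q) yq) chart \<Rightarrow> 'a \<Rightarrow> 'q
     \<Rightarrow> ('a, ('y, 'q) yq) tangent" where
  "d_q A c x \<beta> \<equiv> coord_vec A c x (0, axis \<beta> 1)"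

text \<open>The total space of \<open>E\<^sup>*\<close> consists of pairs of a point \<open>x\<close> and a linear functional on \<open>E x\<close>,
  normalised to be \<open>0\<close> off \<open>E x\<close>. Its charts are the coordinates \<open>((y, q), p)\<close> induced by foliation
  coordinates, where \<open>p\<^sub>\<beta>\<close> is the value of the functional on \<open>\<partial>/\<partial>q\<^sup>\<beta>\<close>.\<close>

type_synonym ('a, 'v) covector = "'a \<times> (('a, 'v) tangent \<Rightarrow> real)"

definition leaf_dual ::
  "('a, 'v::euclidean_space) chart set \<Rightarrow> ('a, 'v) two_field
     \<Rightarrow> ('a, 'v) covector set" where
  "leaf_dual A \<omega> = {(x, a). x \<in> points A \<and> tlinear (ker_form A \<omega> x) a \<and>
     (\<forall>v. v \<notin> ker_form A \<omega> x \<longrightarrow> a v = 0)}"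

definition p_coord ::
  "('a, ('y::finite, 'q::finite) yq) chart set \<Rightarrow> ('a, ('y, 'q) yq) chart
     \<Rightarrow> ('a, ('y, 'q) yq) covector \<Rightarrow> real^'q" where
  "p_coord A c z = (\<chi> \<beta>. snd z (d_q A c (fst z) \<beta>))"

definition lift_chart ::
  "('a, ('y::finite, 'q::finite) yq) chart set \<Rightarrow> ('a, ('y, 'q) yq) two_field
     \<Rightarrow> ('a, ('y, 'q) yq) chart \<Rightarrow> (('a, ('y, 'q) yq) covector, ('y, 'q) yqp) chart" where
  "lift_chart A \<omega> c =
     ({z \<in> leaf_dual A \<omega>. fst z \<in> cdom c}, \<lambda>z. (cmap c (fst z), p_coord A c z))"

definition dual_atlas ::
  "('a, ('y::finite, 'q::finite) yq) chart set \<Rightarrow> ('a, ('y, 'q) yq) two_field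
     \<Rightarrow> (('a, ('y, 'q) yq) covector, ('y, 'q) yqp) chart set" where
  "dual_atlas A \<omega> = lift_chart A \<omega> ` foliation_charts A \<omega>"

definition theta_G ::
  "('a, ('y::finite, 'q::finite) yq) chart set \<Rightarrow> ('a, ('y, 'q) yq) two_field
     \<Rightarrow> ('a, ('y, 'q) yq) distribution \<Rightarrow> ('a, ('y, 'q) yq) covector
     \<Rightarrow> (('a, ('y, 'q) yq) covector, ('y, 'q) yqp) tangent \<Rightarrow> real" where
  "theta_G A \<omega> G z \<xi> =
     snd z (proj_along A \<omega> G (fst z) (differential (dual_atlas A \<omega>) A fst z \<xi>))"

definition omega_U ::
  "('a, ('y::finite, 'q::finite) yq) chart set \<Rightarrow> ('a, ('y, 'q) yq) two_field
     \<Rightarrow> ('a, ('y, 'q) yq) one_field \<Rightarrow> ('a, ('y, 'q) yq) distribution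
     \<Rightarrow> ('a, ('y, 'q) yq) covector \<Rightarrow> (('a, ('y, 'q) yq) covector, ('y, 'q) yqp) tangent
     \<Rightarrow> (('a, ('y, 'q) yq) covector, ('y, 'q) yqp) tangent \<Rightarrow> real" where
  "omega_U A \<omega> b G z \<xi> \<eta> =
     (let T\<pi> = differential (dual_atlas A \<omega>) A fst z
      in \<omega> (fst z) (T\<pi> \<xi>) (T\<pi> \<eta>)
         - ext_deriv1 (dual_atlas A \<omega>) (theta_G A \<omega> G) z \<xi> \<eta>
         - wedge11 (\<lambda>\<zeta>. b (fst z) (T\<pi> \<zeta>)) (theta_G A \<omega> G z) \<xi> \<eta>)"

definition lcs_thickening ::
  "('a, ('y::finite, 'q::finite) yq) chart set \<Rightarrow> ('a, ('y, 'q) yq) two_field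
     \<Rightarrow> ('a, ('y, 'q) yq) one_field \<Rightarrow> ('a, ('y, 'q) yq) distribution
     \<Rightarrow> ('a, ('y, 'q) yq) covector set \<Rightarrow> bool" where
  "lcs_thickening A \<omega> b G U \<longleftrightarrow>
     openin (atlas_topology (dual_atlas A \<omega>)) U \<and>
     (\<forall>x\<in>points A. (x, \<lambda>v. 0) \<in> U) \<and>
     (\<forall>z\<in>U. \<forall>\<xi>\<in>tangent_space (dual_atlas A \<omega>) z.
        (\<forall>\<eta>\<in>tangent_space (dual_atlas A \<omega>) z. omega_U A \<omega> b G z \<xi> \<eta> = 0) \<longrightarrow> \<xi> = (\<lambda>c. 0))"

definition smooth_section ::
  "('a, ('y::finite, 'q::finite) yq) chart set \<Rightarrow> ('a, ('y, 'q) yq) two_field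
     \<Rightarrow> ('a, ('y, 'q) yq) covector set \<Rightarrow> ('a \<Rightarrow> ('a, ('y, 'q) yq) covector) \<Rightarrow> bool" where
  "smooth_section A \<omega> U s \<longleftrightarrow>
     smooth_map A (dual_atlas A \<omega>) s \<and> (\<forall>x\<in>points A. s x \<in> U \<and> fst (s x) = x)"

text \<open>The tangent space of the graph of \<open>s\<close> at \<open>s x\<close> is the image of the differential of \<open>s\<close>.\<close>

definition coisotropic_graph ::
  "('a, ('y::finite, 'q::finite) yq) chart set \<Rightarrow> ('a, ('y, 'q) yq) two_field
     \<Rightarrow> ('a, ('y, 'q) yq) one_field \<Rightarrow> ('a, ('y, 'q) yq) distribution
     \<Rightarrow> ('a \<Rightarrow> ('a, ('y, 'q) yq) covector) \<Rightarrow> bool" where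
  "coisotropic_graph A \<omega> b G s \<longleftrightarrow>
     (\<forall>x\<in>points A.
        let L = differential A (dual_atlas A \<omega>) s x ` tangent_space A x
        in {\<xi> \<in> tangent_space (dual_atlas A \<omega>) (s x). \<forall>\<eta>\<in>L. omega_U A \<omega> b G (s x) \<xi> \<eta> = 0} \<subseteq> L)"


section \<open>Local expressions in foliation coordinates\<close>

text \<open>\<open>G = span {\<partial>/\<partial>y\<^sup>i + R\<^sub>i\<^sup>\<alpha> \<partial>/\<partial>q\<^sup>\<alpha>}\<close>.\<close>

definition R_coef ::
  "('a, ('y::finite, 'q::finite) yq) chart set \<Rightarrow> ('a, ('y, 'q) yq) distribution
     \<Rightarrow> ('a, ('y, 'q) yq) chart \<Rightarrow> 'y \<Rightarrow> 'a \<Rightarrow> real^'q" where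
  "R_coef A G c i x = (THE r. coord_vec A c x (axis i 1, r) \<in> G x)"

definition f_star ::
  "('a, ('y::finite, 'q::finite) yq) chart set \<Rightarrow> ('a, ('y, 'q) yq) distribution
     \<Rightarrow> ('a, ('y, 'q) yq) chart \<Rightarrow> 'a \<Rightarrow> 'q \<Rightarrow> ('a, ('y, 'q) yq) tangent \<Rightarrow> real" where
  "f_star A G c x \<beta> v = snd (v c) $ \<beta> - (\<Sum>i\<in>UNIV. R_coef A G c i x $ \<beta> * fst (v c) $ i)"

text \<open>The vectors \<open>e\<^sub>j\<close> and \<open>f\<^sub>\<alpha>\<close> at \<open>z\<close>, in the induced coordinates \<open>((y, q), p)\<close>. The
  \<open>p\<close>-component of \<open>f\<^sub>\<alpha>\<close> is \<open>- p\<^sub>\<nu> b(\<partial>/\<partial>q\<^sup>\<alpha>)\<close>, in parallel with the term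
  \<open>- p\<^sub>\<nu> b(\<partial>/\<partial>y\<^sup>j + R\<^sub>j\<^sup>\<gamma> \<partial>/\<partial>q\<^sup>\<gamma>)\<close> of \<open>e\<^sub>j\<close>. It makes the span of the \<open>f\<^sub>\<alpha>\<close> isotropic for
  \<open>omega_U\<close>; on the vectors \<open>\<partial>/\<partial>q\<^sup>\<alpha>\<close> themselves \<open>omega_U\<close> takes the values
  \<open>b\<^sub>\<beta> p\<^sub>\<alpha> - b\<^sub>\<alpha> p\<^sub>\<beta>\<close>.\<close>

definition e_vec ::
  "('a, ('y::finite, 'q::finite) yq) chart set \<Rightarrow> ('a, ('y, 'q) yq) one_field
     \<Rightarrow> ('a, ('y, 'q) yq) distribution \<Rightarrow> ('a, ('y, 'q) yq) chart \<Rightarrow> ('a, ('y, 'q) yq) covector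
     \<Rightarrow> 'y \<Rightarrow> ('y, 'q) yqp" where
  "e_vec A b G c z j =
     (let x = fst z; p = p_coord A c z
      in ((axis j 1, R_coef A G c j x),
          \<chi> \<nu>. - (p $ \<nu> * (b x (d_y A c x j) + (\<Sum>\<gamma>\<in>UNIV. b x (d_q A c x \<gamma>) * R_coef A G c j x $ \<gamma>))
                 + (\<Sum>\<beta>\<in>UNIV. p $ \<beta> * cderiv c (\<lambda>x. R_coef A G c j x $ \<beta>) x (0, axis \<nu> 1)))))"

definition f_vec ::
  "('a, ('y::finite, 'q::finite) yq) chart set \<Rightarrow> ('a, ('y, 'q) yq) one_field
     \<Rightarrow> ('a, ('y, 'q) yq) chart \<Rightarrow> ('a, ('y, 'q) yq) covector \<Rightarrow> 'q \<Rightarrow> ('y, 'q) yqp" where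
  "f_vec A b c z \<alpha> =
     ((0, axis \<alpha> 1), \<chi> \<nu>. - (p_coord A c z $ \<nu> * b (fst z) (d_q A c (fst z) \<alpha>)))"

text \<open>The \<open>p\<close>-components of the projection of \<open>\<xi>\<close> to the vertical bundle along the span of the
  \<open>e\<^sub>j\<close> and \<open>f\<^sub>\<alpha>\<close>.\<close>

definition vertical_proj ::
  "('a, ('y::finite, 'q::finite) yq) chart set \<Rightarrow> ('a, ('y, 'q) yq) two_field
     \<Rightarrow> ('a, ('y, 'q) yq) one_field \<Rightarrow> ('a, ('y, 'q) yq) distribution \<Rightarrow> ('a, ('y, 'q) yq) chart
     \<Rightarrow> ('a, ('y, 'q) yq) covector \<Rightarrow> (('a, ('y, 'q) yq) covector, ('y, 'q) yqp) tangent
     \<Rightarrow> real^'q" where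
  "vertical_proj A \<omega> b G c z \<xi> =
     (THE r. \<xi> (lift_chart A \<omega> c) - (0, r) \<in> span (range (e_vec A b G c z) \<union> range (f_vec A b c z)))"

definition nabla ::
  "('a, ('y::finite, 'q::finite) yq) chart set \<Rightarrow> ('a, ('y, 'q) yq) two_field
     \<Rightarrow> ('a, ('y, 'q) yq) one_field \<Rightarrow> ('a, ('y, 'q) yq) distribution
     \<Rightarrow> ('a \<Rightarrow> ('a, ('y, 'q) yq) covector) \<Rightarrow> ('a, ('y, 'q) yq) chart \<Rightarrow> 'a
     \<Rightarrow> ('a, ('y, 'q) yq) tangent \<Rightarrow> real^'q" where
  "nabla A \<omega> b G s c x v =
     vertical_proj A \<omega> b G c (s x) (differential A (dual_atlas A \<omega>) s x v)"

text \<open>The components are taken in the frame \<open>\<partial>/\<partial>y\<^sup>i + R\<^sub>i\<^sup>\<alpha> \<partial>/\<partial>q\<^sup>\<alpha>\<close>, \<open>\<partial>/\<partial>q\<^sup>\<beta>\<close> of \<open>G \<oplus> E\<close>, which is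
  dual to the coframe \<open>dy\<^sup>i\<close>, \<open>f\<^sub>\<beta>\<^sup>*\<close>. Explicitly, \<open>nabla_y\<close> is
  \<open>(\<partial>/\<partial>y\<^sup>i + R\<^sub>i\<^sup>\<gamma> \<partial>/\<partial>q\<^sup>\<gamma>) s\<^sub>\<alpha> + s\<^sub>\<alpha> (b\<^sub>i + b\<^sub>\<gamma> R\<^sub>i\<^sup>\<gamma>) + s\<^sub>\<beta> \<partial>R\<^sub>i\<^sup>\<beta>/\<partial>q\<^sup>\<alpha>\<close> and \<open>nabla_q\<close> is
  \<open>\<partial>s\<^sub>\<alpha>/\<partial>q\<^sup>\<beta> + b\<^sub>\<beta> s\<^sub>\<alpha>\<close>.\<close>

definition nabla_y ::
  "('a, ('y::finite, 'q::finite) yq) chart set \<Rightarrow> ('a, ('y, 'q) yq) two_field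
     \<Rightarrow> ('a, ('y, 'q) yq) one_field \<Rightarrow> ('a, ('y, 'q) yq) distribution
     \<Rightarrow> ('a \<Rightarrow> ('a, ('y, 'q) yq) covector) \<Rightarrow> ('a, ('y, 'q) yq) chart \<Rightarrow> 'a \<Rightarrow> 'y \<Rightarrow> 'q \<Rightarrow> real" where
  "nabla_y A \<omega> b G s c x i \<alpha> =
     nabla A \<omega> b G s c x (coord_vec A c x (axis i 1, R_coef A G c i x)) $ \<alpha>"

definition nabla_q ::
  "('a, ('y::finite, 'q::finite) yq) chart set \<Rightarrow> ('a, ('y, 'q) yq) two_field
     \<Rightarrow> ('a, ('y, 'q) yq) one_field \<Rightarrow> ('a, ('y, 'q) yq) distribution
     \<Rightarrow> ('a \<Rightarrow> ('a, ('y, 'q) yq) covector) \<Rightarrow> ('a, ('y, 'q) yq) chart \<Rightarrow> 'a \<Rightarrow> 'q \<Rightarrow> 'q \<Rightarrow> real" where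
  "nabla_q A \<omega> b G s c x \<beta> \<alpha> = nabla A \<omega> b G s c x (d_q A c x \<beta>) $ \<alpha>"

definition F_curv ::
  "('a, ('y::finite, 'q::finite) yq) chart set \<Rightarrow> ('a, ('y, 'q) yq) distribution
     \<Rightarrow> ('a, ('y, 'q) yq) chart \<Rightarrow> 'a \<Rightarrow> 'q \<Rightarrow> 'y \<Rightarrow> 'y \<Rightarrow> real" where
  "F_curv A G c x \<beta> i j =
     (let R = (\<lambda>i x. R_coef A G c i x $ \<beta>)
      in cderiv c (R j) x (axis i 1, 0) - cderiv c (R i) x (axis j 1, 0)
         + (\<Sum>\<gamma>\<in>UNIV. R_coef A G c i x $ \<gamma> * cderiv c (R j) x (0, axis \<gamma> 1))
         - (\<Sum>\<gamma>\<in>UNIV. R_coef A G c j x $ \<gamma> * cderiv c (R i) x (0, axis \<gamma> 1)))"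

text \<open>With the present signs in \<open>omega_U\<close> and \<open>F_curv\<close> this is \<open>omega_U\<close> evaluated on
  \<open>e\<^sub>i\<close>, \<open>e\<^sub>j\<close> at \<open>s x\<close>.\<close>

definition omega_tilde ::
  "('a, ('y::finite, 'q::finite) yq) chart set \<Rightarrow> ('a, ('y, 'q) yq) two_field
     \<Rightarrow> ('a, ('y, 'q) yq) distribution \<Rightarrow> ('a \<Rightarrow> ('a, ('y, 'q) yq) covector)
     \<Rightarrow> ('a, ('y, 'q) yq) chart \<Rightarrow> 'a \<Rightarrow> real^'y^'y" where
  "omega_tilde A \<omega> G s c x =
     (\<chi> i j. \<omega> x (d_y A c x i) (d_y A c x j)
        + (\<Sum>\<beta>\<in>UNIV. p_coord A c (s x) $ \<beta> * F_curv A G c x \<beta> i j))"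

text \<open>Index convention for the inverse: \<open>\<omega>\<^sup>i\<^sup>j \<omega>\<^sub>k\<^sub>j = \<delta>\<^sup>i\<^sub>k\<close>, i.e. \<open>\<omega>\<^sup>i\<^sup>j\<close> is \<open>\<omega>\<^sub>i\<^sub>j\<close> with both indices
  raised by means of \<open>\<omega>\<close> itself. The matrix is skew, so the other convention differs by a sign.\<close>

definition omega_tilde_inv ::
  "('a, ('y::finite, 'q::finite) yq) chart set \<Rightarrow> ('a, ('y, 'q) yq) two_field
     \<Rightarrow> ('a, ('y, 'q) yq) distribution \<Rightarrow> ('a \<Rightarrow> ('a, ('y, 'q) yq) covector)
     \<Rightarrow> ('a, ('y, 'q) yq) chart \<Rightarrow> 'a \<Rightarrow> real^'y^'y" where
  "omega_tilde_inv A \<omega> G s c x = transpose (matrix_inv (omega_tilde A \<omega> G s c x))"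

end

theory Submission
  imports Defs
begin

text \<open>
Let \<open>c\<close> be a foliation chart around \<open>x\<close>. A tangent vector of \<open>E\<^sup>*\<close> at \<open>s x\<close> has induced coordinates
\<open>((a, t), \<pi>)\<close>. The proof replaces them by its coefficients \<open>(a, \<tau>, \<rho>)\<close> in the frame \<open>e\<^sub>j\<close>, \<open>f\<^sub>\<alpha>\<close>,
\<open>\<partial>/\<partial>p\<^sub>\<nu>\<close>. Here \<open>\<tau> = t - a\<^sub>i R\<^sub>i\<close> represents the projection to the leaf direction along \<open>G\<close> and \<open>\<rho>\<close>
is the vertical projection. The frame is chosen so that all mixed terms cancel and the two-form
becomes

  \<open>\<omega>\<^sub>U(\<xi>, \<xi>') = a\<^sub>i W\<^sub>i\<^sub>j a'\<^sub>j - \<rho> \<cdot> \<tau>' + \<rho>' \<cdot> \<tau>\<close>, where \<open>W = omega_tilde\<close>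

(lemma \<open>omega_U_coord\<close>). In particular nondegeneracy of \<open>\<omega>\<^sub>U\<close> forces the skew matrix \<open>W\<close> to be
invertible.

By definition of \<open>\<nabla>s\<close>, a vector is tangent to the graph of \<open>s\<close> exactly if \<open>\<rho> = N\<^sup>T a + M\<^sup>T \<tau>\<close>, where
the rows of \<open>N\<close> and \<open>M\<close> are the values of \<open>\<nabla>s\<close> on the frame \<open>\<partial>/\<partial>y\<^sup>i + R\<^sub>i\<^sup>\<alpha> \<partial>/\<partial>q\<^sup>\<alpha>\<close>, \<open>\<partial>/\<partial>q\<^sup>\<beta>\<close> of
\<open>G \<oplus> E\<close>. Testing against all such vectors, the orthogonal of this space consists of the
\<open>(a, \<tau>, \<rho>)\<close> with \<open>W a = N \<tau>\<close> and \<open>\<rho> = M \<tau>\<close>. It is parametrised by \<open>\<tau>\<close>, and it lies in the tangent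
space of the graph if and only if \<open>N\<^sup>T W\<^sup>-\<^sup>1 N = M - M\<^sup>T\<close> (lemma \<open>coisotropic_graph_linear\<close>). The
entries of this matrix identity are the stated equations. Both sides are skew, which is why the
pairs \<open>\<alpha> > \<beta>\<close> suffice and why the identity may be read as an equality of two-forms.

What remains is to compute \<open>\<omega>\<^sub>U\<close> in the coordinates of \<open>c\<close>, whereas the exterior derivative of
\<open>\<theta>\<^sub>G\<close> is defined by means of some arbitrary chart of \<open>E\<^sup>*\<close>. Exterior derivatives of smooth one-forms
do not depend on the chart, because second derivatives of coordinate changes are symmetric (lemma
\<open>ext_deriv1_chart\<close>). To apply this, the induced coordinates must form a smooth atlas of \<open>E\<^sup>*\<close> and
\<open>\<theta>\<^sub>G\<close> must be smooth; both follow from closure properties of smooth functions.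
\<close>

section \<open>Smooth functions on open sets\<close>

lemma has_frechet: "f differentiable (at u) \<Longrightarrow> (f has_derivative frechet_derivative f (at u)) (at u)"
  by (simp add: frechet_derivative_works)

lemma frechet_eq: "(f has_derivative f') (at u) \<Longrightarrow> frechet_derivative f (at u) = f'"
  using frechet_derivative_at by metis

lemma frechet_bounded_linear:
  "f differentiable (at u) \<Longrightarrow> bounded_linear (frechet_derivative f (at u))"
  using has_frechet has_derivative_bounded_linear by blast

text \<open>Values off the open set \<open>S\<close> are irrelevant, so formulas for coordinate expressions have to be known
  only on the image of a chart.\<close>

lemma Ck_on_cong:
  assumes "open S" "\<And>u. u \<in> S \<Longrightarrow> f u = g u" "Ck_on n S f"
  shows "Ck_on n S g"
  using assms(2,3)
proof (induction n arbitrary: f g)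
  case 0
  then show ?case by (simp cong: continuous_on_cong)
next
  case (Suc n)
  have d: "(g has_derivative frechet_derivative f (at u)) (at u)" if "u \<in> S" for u
    using has_derivative_transform_within_open[OF has_frechet assms(1) that Suc.prems(1)] Suc.prems(2) that
    by auto
  show ?case
    unfolding Ck_on.simps
  proof (intro conjI ballI allI)
    fix e
    show "Ck_on n S (\<lambda>u. frechet_derivative g (at u) e)"
      using Suc.IH[of "\<lambda>u. frechet_derivative f (at u) e" "\<lambda>u. frechet_derivative g (at u) e"]
        frechet_eq[OF d] Suc.prems(2) by simp
  qed (use d differentiable_def in blast)
qed

text \<open>Any derivative may be used in place of the chosen \<open>frechet_derivative\<close>. Together with induction on
  the order of differentiability this gives the closure properties below from the usual
  differentiation rules.\<close>

lemma Ck_on_SucI: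
  assumes "open S" "\<And>u. u \<in> S \<Longrightarrow> (f has_derivative f' u) (at u)"
    "\<And>e. Ck_on n S (\<lambda>u. f' u e)"
  shows "Ck_on (Suc n) S f"
  unfolding Ck_on.simps
proof (intro conjI ballI allI)
  fix e
  show "Ck_on n S (\<lambda>u. frechet_derivative f (at u) e)"
    by (rule Ck_on_cong[OF assms(1) _ assms(3)[of e]]) (simp add: frechet_eq[OF assms(2)])
qed (use assms(2) differentiable_def in blast)

lemma Ck_on_SucD: "Ck_on (Suc n) S f \<Longrightarrow> Ck_on n S f"
proof (induction n arbitrary: f)
  case 0
  then show ?case
    by (auto intro!: differentiable_imp_continuous_on differentiable_at_imp_differentiable_on)
next
  case (Suc n)
  show ?case
    using Suc.prems Suc.IH by (subst Ck_on.simps(2)) (auto simp del: Ck_on.simps(1) simp: Ck_on.simps(2)[of "Suc n"])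
qed

lemma Ck_on_const: "open S \<Longrightarrow> Ck_on n S (\<lambda>u. c)"
  by (induction n arbitrary: c) auto

lemma Ck_on_bounded_linear:
  assumes "open S" "bounded_linear f"
  shows "Ck_on n S f"
proof (cases n)
  case 0
  then show ?thesis
    using assms(2) by (auto intro: linear_continuous_on)
next
  case (Suc m)
  have "Ck_on (Suc m) S f"
    by (rule Ck_on_SucI[OF assms(1)])
      (rule bounded_linear_imp_has_derivative[OF assms(2)], rule Ck_on_const[OF assms(1)])
  then show ?thesis by (simp only: Suc)
qed

lemma Ck_on_linear_compose:
  assumes "open S" "bounded_linear h" "Ck_on n S f"
  shows "Ck_on n S (\<lambda>u. h (f u))"
  using assms(3)
proof (induction n arbitrary: f)
  case 0
  then show ?case
    using bounded_linear.continuous_on[OF assms(2)] by simp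
next
  case (Suc n)
  show ?case
  proof (rule Ck_on_SucI[OF assms(1)])
    show "((\<lambda>u. h (f u)) has_derivative (\<lambda>e. h (frechet_derivative f (at u) e))) (at u)" if "u \<in> S" for u
      using bounded_linear.has_derivative[OF assms(2) has_frechet] Suc.prems that by auto
  qed (use Suc in auto)
qed

lemma Ck_on_add:
  assumes "open S" "Ck_on n S f" "Ck_on n S g"
  shows "Ck_on n S (\<lambda>u. f u + g u)"
  using assms(2,3)
proof (induction n arbitrary: f g)
  case 0
  then show ?case by (auto intro: continuous_intros)
next
  case (Suc n)
  show ?case
  proof (rule Ck_on_SucI[OF assms(1)])
    show "((\<lambda>u. f u + g u) has_derivative (\<lambda>e. frechet_derivative f (at u) e + frechet_derivative g (at u) e)) (at u)"
      if "u \<in> S" for u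
      using has_derivative_add[OF has_frechet has_frechet, of f u g] Suc.prems that by simp
  qed (use Suc in auto)
qed

lemma Ck_on_bilinear:
  assumes "open S" "bounded_bilinear h" "Ck_on n S f" "Ck_on n S g"
  shows "Ck_on n S (\<lambda>u. h (f u) (g u))"
  using assms(3,4)
proof (induction n arbitrary: f g)
  case 0
  then show ?case using bounded_bilinear.continuous_on[OF assms(2)] by auto
next
  case (Suc n)
  show ?case
  proof (rule Ck_on_SucI[OF assms(1)])
    show "((\<lambda>u. h (f u) (g u)) has_derivative (\<lambda>e. h (f u) (frechet_derivative g (at u) e)
        + h (frechet_derivative f (at u) e) (g u))) (at u)" if "u \<in> S" for u
      using bounded_bilinear.FDERIV[OF assms(2) has_frechet has_frechet, of f u g] Suc.prems that by simp
    show "Ck_on n S (\<lambda>u. h (f u) (frechet_derivative g (at u) e) + h (frechet_derivative f (at u) e) (g u))" for e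
      using Suc.prems Ck_on_SucD[OF Suc.prems(1)] Ck_on_SucD[OF Suc.prems(2)]
      by (intro Ck_on_add assms(1) Suc.IH) auto
  qed
qed

lemma Ck_on_sum:
  assumes "open S" "\<And>i. i \<in> I \<Longrightarrow> Ck_on n S (f i)"
  shows "Ck_on n S (\<lambda>u. \<Sum>i\<in>I. f i u)"
  using assms(2)
  by (induction I rule: infinite_finite_induct) (auto intro: Ck_on_const Ck_on_add assms(1))

text \<open>Writes the chain rule as a finite sum of products, so that the induction for compositions can use
  closure under sums and bilinear operations.\<close>

lemma linear_basis_expansion:
  fixes f :: "'v::euclidean_space \<Rightarrow> 'w::real_vector"
  assumes "linear f"
  shows "f e = (\<Sum>i\<in>Basis. (e \<bullet> i) *\<^sub>R f i)"
proof -
  have "f e = f (\<Sum>i\<in>Basis. (e \<bullet> i) *\<^sub>R i)" by (simp add: euclidean_representation)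
  also have "\<dots> = (\<Sum>i\<in>Basis. (e \<bullet> i) *\<^sub>R f i)"
    by (simp add: linear_sum[OF assms] linear_scale[OF assms])
  finally show ?thesis .
qed

lemma Ck_on_compose:
  fixes g :: "'u::real_normed_vector \<Rightarrow> 'v::euclidean_space"
  assumes "open S" "open T" "g ` S \<subseteq> T" "Ck_on n S g" "Ck_on n T f"
  shows "Ck_on n S (\<lambda>u. f (g u))"
  using assms(4,5)
proof (induction n arbitrary: f)
  case 0
  then show ?case using assms(3) by (auto intro: continuous_on_compose2)
next
  case (Suc n)
  have lin: "linear (frechet_derivative f (at (g u)))" if "u \<in> S" for u
    using Suc.prems(2) that assms(3) by (auto intro!: bounded_linear.linear frechet_bounded_linear)
  show ?case
  proof (rule Ck_on_SucI[OF assms(1)])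
    show "((\<lambda>u. f (g u)) has_derivative (\<lambda>e. \<Sum>i\<in>Basis. (frechet_derivative g (at u) e \<bullet> i) *\<^sub>R
        frechet_derivative f (at (g u)) i)) (at u)" if "u \<in> S" for u
    proof -
      have "g differentiable (at u)" "f differentiable (at (g u))"
        using Suc.prems assms(3) that by auto
      from has_derivative_compose[OF has_frechet[OF this(1)] has_frechet[OF this(2)]]
      show ?thesis by (subst (asm) linear_basis_expansion[OF lin[OF that]])
    qed
    show "Ck_on n S (\<lambda>u. \<Sum>i\<in>Basis. (frechet_derivative g (at u) e \<bullet> i) *\<^sub>R
        frechet_derivative f (at (g u)) i)" for e
    proof (intro Ck_on_sum assms(1) Ck_on_bilinear[OF assms(1) bounded_bilinear_scaleR])
      fix i :: 'v
      show "Ck_on n S (\<lambda>u. frechet_derivative g (at u) e \<bullet> i)"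
        using Suc.prems by (auto intro!: Ck_on_linear_compose[OF assms(1) bounded_linear_inner_left])
      show "Ck_on n S (\<lambda>u. frechet_derivative f (at (g u)) i)"
        using Suc.prems(2) by (intro Suc.IH[OF Ck_on_SucD[OF Suc.prems(1)]]) auto
    qed
  qed
qed

lemma smooth_on_cong: "open S \<Longrightarrow> (\<And>u. u \<in> S \<Longrightarrow> f u = g u) \<Longrightarrow> smooth_on S f \<Longrightarrow> smooth_on S g"
  unfolding smooth_on_def using Ck_on_cong by blast

lemma smooth_on_const: "open S \<Longrightarrow> smooth_on S (\<lambda>u. c)"
  unfolding smooth_on_def using Ck_on_const by blast

lemma smooth_on_linear_compose:
  "open S \<Longrightarrow> bounded_linear h \<Longrightarrow> smooth_on S f \<Longrightarrow> smooth_on S (\<lambda>u. h (f u))"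
  unfolding smooth_on_def using Ck_on_linear_compose by blast

lemma smooth_on_bounded_linear: "open S \<Longrightarrow> bounded_linear h \<Longrightarrow> smooth_on S h"
  unfolding smooth_on_def using Ck_on_bounded_linear by blast

lemma smooth_on_add:
  "open S \<Longrightarrow> smooth_on S f \<Longrightarrow> smooth_on S g \<Longrightarrow> smooth_on S (\<lambda>u. f u + g u)"
  unfolding smooth_on_def using Ck_on_add by blast

lemma smooth_on_bilinear:
  "open S \<Longrightarrow> bounded_bilinear h \<Longrightarrow> smooth_on S f \<Longrightarrow> smooth_on S g \<Longrightarrow> smooth_on S (\<lambda>u. h (f u) (g u))"
  unfolding smooth_on_def using Ck_on_bilinear by blast

lemma smooth_on_sum:
  "open S \<Longrightarrow> (\<And>i. i \<in> I \<Longrightarrow> smooth_on S (f i)) \<Longrightarrow> smooth_on S (\<lambda>u. \<Sum>i\<in>I. f i u)"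
  unfolding smooth_on_def by (auto intro!: Ck_on_sum)

lemma smooth_on_compose:
  fixes g :: "'u::real_normed_vector \<Rightarrow> 'v::euclidean_space"
  shows "open S \<Longrightarrow> open T \<Longrightarrow> g ` S \<subseteq> T \<Longrightarrow> smooth_on S g \<Longrightarrow> smooth_on T f \<Longrightarrow> smooth_on S (\<lambda>u. f (g u))"
  unfolding smooth_on_def using Ck_on_compose by blast

lemma smooth_on_Pair:
  assumes "open S" "smooth_on S f" "smooth_on S g"
  shows "smooth_on S (\<lambda>u. (f u, g u))"
proof -
  have "bounded_linear (\<lambda>x. (x, 0))" "bounded_linear (\<lambda>x. (0, x))"
    by (rule bounded_linear_Pair[OF bounded_linear_ident bounded_linear_zero],
        rule bounded_linear_Pair[OF bounded_linear_zero bounded_linear_ident])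
  then have "smooth_on S (\<lambda>u. (f u, 0) + (0, g u))"
    using smooth_on_linear_compose[OF assms(1) _ assms(2)] smooth_on_linear_compose[OF assms(1) _ assms(3)]
    by (intro smooth_on_add assms(1)) auto
  then show ?thesis by simp
qed

lemma smooth_on_compose_fst:
  fixes f :: "'v::euclidean_space \<Rightarrow> 'w::real_normed_vector"
  assumes "open S" "smooth_on S f"
  shows "smooth_on (S \<times> (UNIV :: 'u::euclidean_space set)) (\<lambda>w. f (fst w))"
proof (rule smooth_on_compose[OF _ assms(1) _ _ assms(2)])
  show "open (S \<times> (UNIV :: 'u set))" using assms(1) by (simp add: open_Times)
  then show "smooth_on (S \<times> (UNIV :: 'u set)) fst"
    by (rule smooth_on_bounded_linear[OF _ bounded_linear_fst])
qed auto

lemma smooth_on_vec_lambda: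
  fixes f :: "'v::real_normed_vector \<Rightarrow> 'n::finite \<Rightarrow> real"
  assumes "open S" "\<And>i. smooth_on S (\<lambda>u. f u i)"
  shows "smooth_on S (\<lambda>u. \<chi> i. f u i)"
proof -
  have "smooth_on S (\<lambda>u. \<Sum>i\<in>UNIV. f u i *\<^sub>R (axis i 1 :: real^'n))"
    by (intro smooth_on_sum assms(1)
        smooth_on_linear_compose[OF assms(1) bounded_linear_scaleR_left assms(2)])
  also have "(\<lambda>u. \<Sum>i\<in>UNIV. f u i *\<^sub>R (axis i 1 :: real^'n)) = (\<lambda>u. \<chi> i. f u i)"
    using basis_expansion[of "\<chi> i. f _ i"] by (auto simp: scalar_mult_eq_scaleR)
  finally show ?thesis .
qed

lemma smooth_on_derivative:
  "smooth_on S f \<Longrightarrow> smooth_on S (\<lambda>u. frechet_derivative f (at u) e)"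
  unfolding smooth_on_def by (metis Ck_on.simps(2))

lemma smooth_on_differentiable: "smooth_on S f \<Longrightarrow> u \<in> S \<Longrightarrow> f differentiable (at u)"
  unfolding smooth_on_def by (metis Ck_on.simps(2))

section \<open>Symmetry of second derivatives\<close>

text \<open>By the mean value theorem in the direction \<open>d\<close>, the second difference is \<open>t\<close> times
  \<open>D\<^sub>d f (x + t e + h d) - D\<^sub>d f (x + h d)\<close> for some \<open>h\<close> between \<open>0\<close> and \<open>t\<close>. In the affine approximation of
  \<open>D\<^sub>d f\<close> at \<open>x\<close> the displacement \<open>h d\<close> cancels, and the remainder is \<open>o(t)\<close>. Differentiability of \<open>D\<^sub>d f\<close>
  at the single point \<open>x\<close> is therefore enough.\<close>

lemma second_difference_limit:
  fixes f :: "'v::real_normed_vector \<Rightarrow> real"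
  assumes "open S" "x \<in> S" "\<And>u. u \<in> S \<Longrightarrow> f differentiable (at u)"
    and D: "((\<lambda>u. frechet_derivative f (at u) d) has_derivative L) (at x)"
  shows "((\<lambda>t. (f (x + t *\<^sub>R e + t *\<^sub>R d) - f (x + t *\<^sub>R e) - f (x + t *\<^sub>R d) + f x) / t\<^sup>2)
           \<longlongrightarrow> L e) (at_right 0)"
proof (rule tendstoI)
  fix \<epsilon> :: real assume "\<epsilon> > 0"
  define g where "g u = frechet_derivative f (at u) d" for u
  \<comment> \<open>Each of the two increments below contributes an error of at most \<open>\<epsilon> t (norm e + norm d) / (2 N)\<close>;
    the summand 1 keeps \<open>N\<close> positive and the final estimate strict.\<close>
  define N where "N = norm e + norm d + 1"
  have N: "N > 0" by (simp add: N_def add_nonneg_pos)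
  interpret L: bounded_linear L using D by (rule has_derivative_bounded_linear)
  obtain \<delta>1 where \<delta>1: "\<delta>1 > 0" "ball x \<delta>1 \<subseteq> S" using assms(1,2) openE by blast
  from D N \<open>\<epsilon> > 0\<close> obtain \<delta>2 where \<delta>2: "\<delta>2 > 0" and
    g: "\<And>y. norm (y - x) < \<delta>2 \<Longrightarrow> \<bar>g y - g x - L (y - x)\<bar> \<le> (\<epsilon> / (2 * N)) * norm (y - x)"
    unfolding has_derivative_at_alt g_def by (metis divide_pos_pos mult_pos_pos zero_less_numeral real_norm_def)
  define \<delta> where "\<delta> = min \<delta>1 \<delta>2 / N"
  have "\<delta> > 0" using \<delta>1 \<delta>2 N by (simp add: \<delta>_def)
  have main: "\<bar>(f (x + t *\<^sub>R e + t *\<^sub>R d) - f (x + t *\<^sub>R e) - f (x + t *\<^sub>R d) + f x) / t\<^sup>2 - L e\<bar> < \<epsilon>"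
    if t: "0 < t" "t < \<delta>" for t
  proof -
    have small: "norm (r *\<^sub>R e + h *\<^sub>R d) \<le> t * (norm e + norm d)" if "0 \<le> r" "r \<le> t" "0 \<le> h" "h \<le> t" for r h
    proof -
      have "norm (r *\<^sub>R e + h *\<^sub>R d) \<le> r * norm e + h * norm d"
        using that norm_triangle_ineq[of "r *\<^sub>R e" "h *\<^sub>R d"] by simp
      also have "\<dots> \<le> t * norm e + t * norm d"
        using that by (intro add_mono mult_right_mono) auto
      finally show ?thesis by (simp add: algebra_simps)
    qed
    have tN: "t * (norm e + norm d) < min \<delta>1 \<delta>2"
    proof -
      have "t * (norm e + norm d) \<le> t * N" using t by (intro mult_left_mono) (auto simp: N_def)
      also have "\<dots> < min \<delta>1 \<delta>2" using t N by (simp add: \<delta>_def pos_less_divide_eq)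
      finally show ?thesis .
    qed
    have inS: "x + r *\<^sub>R e + h *\<^sub>R d \<in> S" if "0 \<le> r" "r \<le> t" "0 \<le> h" "h \<le> t" for r h
      using small[OF that] tN \<delta>1(2) by (auto simp: dist_norm subset_iff add.assoc norm_minus_commute)
    \<comment> \<open>The second difference is \<open>\<phi> t - \<phi> 0\<close>.\<close>
    define \<phi> where "\<phi> h = f (x + t *\<^sub>R e + h *\<^sub>R d) - f (x + h *\<^sub>R d)" for h
    have "DERIV \<phi> h :> g (x + t *\<^sub>R e + h *\<^sub>R d) - g (x + h *\<^sub>R d)" if "0 \<le> h" "h \<le> t" for h
    proof -
      have 1: "((\<lambda>h. f (z + h *\<^sub>R d)) has_derivative (\<lambda>k. k * g (z + h *\<^sub>R d))) (at h)"
        if "z + h *\<^sub>R d \<in> S" for z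
      proof -
        have "((\<lambda>h. z + h *\<^sub>R d) has_derivative (\<lambda>k. k *\<^sub>R d)) (at h)"
          by (auto intro!: derivative_eq_intros)
        from has_derivative_compose[OF this has_frechet[OF assms(3)[OF that]]]
        show ?thesis
          using linear_scale[OF bounded_linear.linear[OF frechet_bounded_linear[OF assms(3)[OF that]]]]
          by (simp add: g_def)
      qed
      have "((\<lambda>h. f (x + t *\<^sub>R e + h *\<^sub>R d) - f (x + h *\<^sub>R d)) has_derivative
          (\<lambda>k. k * g (x + t *\<^sub>R e + h *\<^sub>R d) - k * g (x + h *\<^sub>R d))) (at h)"
        using inS[of t h] inS[of 0 h] that t by (intro has_derivative_diff 1) auto
      then show ?thesis
        unfolding \<phi>_def has_field_derivative_def
        by (rule has_derivative_eq_rhs) (auto simp: fun_eq_iff algebra_simps)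
    qed
    from MVT2[OF t(1) this] obtain h where h: "0 < h" "h < t"
      and eq: "\<phi> t - \<phi> 0 = t * (g (x + t *\<^sub>R e + h *\<^sub>R d) - g (x + h *\<^sub>R d))" by auto
    have b1: "\<bar>g (x + t *\<^sub>R e + h *\<^sub>R d) - g x - L (t *\<^sub>R e + h *\<^sub>R d)\<bar> \<le> (\<epsilon> / (2 * N)) * (t * (norm e + norm d))"
    proof -
      have "norm (t *\<^sub>R e + h *\<^sub>R d) \<le> t * (norm e + norm d)" using small[of t h] h by auto
      moreover have "\<epsilon> / (2*N) \<ge> 0" using \<open>\<epsilon> > 0\<close> N by simp
      ultimately show ?thesis
        using g[of "x + t *\<^sub>R e + h *\<^sub>R d"] tN
        by (smt (verit, ccfv_SIG) add.assoc add_diff_cancel_left' mult_left_mono)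
    qed
    have b2: "\<bar>g (x + h *\<^sub>R d) - g x - L (h *\<^sub>R d)\<bar> \<le> (\<epsilon> / (2 * N)) * (t * (norm e + norm d))"
    proof -
      have "norm (h *\<^sub>R d) \<le> t * (norm e + norm d)" using small[of 0 h] h t by auto
      moreover have "\<epsilon> / (2*N) \<ge> 0" using \<open>\<epsilon> > 0\<close> N by simp
      ultimately show ?thesis
        using g[of "x + h *\<^sub>R d"] tN
        by (smt (verit, ccfv_SIG) add_diff_cancel_left' mult_left_mono)
    qed
    have "\<bar>(g (x + t *\<^sub>R e + h *\<^sub>R d) - g (x + h *\<^sub>R d)) - t * L e\<bar> \<le> 2 * ((\<epsilon> / (2 * N)) * (t * (norm e + norm d)))"
      using b1 b2 unfolding L.add L.scaleR real_scaleR_def by linarith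
    also have "\<dots> = t * (\<epsilon> * ((norm e + norm d) / N))"
    proof -
      have "2 * ((\<epsilon> / (2 * N)) * (t * M)) = t * (\<epsilon> * (M / N))" for M
        using N by (simp add: field_simps)
      then show ?thesis .
    qed
    also have "\<dots> < t * (\<epsilon> * 1)"
      using t \<open>\<epsilon> > 0\<close> N by (intro mult_strict_left_mono) (auto simp: N_def add_nonneg_pos pos_divide_less_eq)
    finally have "\<bar>(g (x + t *\<^sub>R e + h *\<^sub>R d) - g (x + h *\<^sub>R d)) - t * L e\<bar> / t < \<epsilon>"
      using t by (simp add: pos_divide_less_eq mult.commute)
    moreover have "(f (x + t *\<^sub>R e + t *\<^sub>R d) - f (x + t *\<^sub>R e) - f (x + t *\<^sub>R d) + f x) / t\<^sup>2 - L e
       = ((g (x + t *\<^sub>R e + h *\<^sub>R d) - g (x + h *\<^sub>R d)) - t * L e) / t"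
    proof -
      have "f (x + t *\<^sub>R e + t *\<^sub>R d) - f (x + t *\<^sub>R e) - f (x + t *\<^sub>R d) + f x =
          t * (g (x + t *\<^sub>R e + h *\<^sub>R d) - g (x + h *\<^sub>R d))"
        using eq by (simp add: \<phi>_def)
      then show ?thesis using t by (simp add: power2_eq_square diff_divide_distrib)
    qed
    ultimately show ?thesis using t by (simp add: abs_divide)
  qed
  show "\<forall>\<^sub>F t in at_right 0. dist ((f (x + t *\<^sub>R e + t *\<^sub>R d) - f (x + t *\<^sub>R e) - f (x + t *\<^sub>R d) + f x) / t\<^sup>2) (L e) < \<epsilon>"
    unfolding eventually_at_right_field using main \<open>\<delta> > 0\<close> by (auto simp: dist_real_def)
qed

text \<open>The second difference is symmetric in the two directions, hence so is its limit.\<close>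

lemma second_derivative_symmetric_real:
  fixes f :: "'v::real_normed_vector \<Rightarrow> real"
  assumes "open S" "x \<in> S" "smooth_on S f"
  shows "frechet_derivative (\<lambda>u. frechet_derivative f (at u) d) (at x) e =
         frechet_derivative (\<lambda>u. frechet_derivative f (at u) e) (at x) d"
proof -
  have D: "((\<lambda>u. frechet_derivative f (at u) d) has_derivative
      frechet_derivative (\<lambda>u. frechet_derivative f (at u) d) (at x)) (at x)" for d
    by (rule has_frechet[OF smooth_on_differentiable[OF smooth_on_derivative[OF assms(3)] assms(2)]])
  note lim = second_difference_limit[OF assms(1,2) smooth_on_differentiable[OF assms(3)] D]
  have "(\<lambda>t. (f (x + t *\<^sub>R d + t *\<^sub>R e) - f (x + t *\<^sub>R d) - f (x + t *\<^sub>R e) + f x) / t\<^sup>2) =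
    (\<lambda>t. (f (x + t *\<^sub>R e + t *\<^sub>R d) - f (x + t *\<^sub>R e) - f (x + t *\<^sub>R d) + f x) / t\<^sup>2)"
    by (auto simp: algebra_simps)
  then show ?thesis
    using tendsto_unique[OF _ lim[of d e]] lim[of e d] by simp
qed

lemma second_derivative_symmetric:
  fixes f :: "'v::real_normed_vector \<Rightarrow> 'w::euclidean_space"
  assumes "open S" "x \<in> S" "smooth_on S f"
  shows "frechet_derivative (\<lambda>u. frechet_derivative f (at u) d) (at x) e =
         frechet_derivative (\<lambda>u. frechet_derivative f (at u) e) (at x) d"
proof (rule euclidean_eqI)
  fix i :: 'w assume "i \<in> Basis"
  have sm: "smooth_on S (\<lambda>u. f u \<bullet> i)"
    using smooth_on_linear_compose[OF assms(1) bounded_linear_inner_left assms(3)] by simp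
  have 1: "frechet_derivative (\<lambda>u. f u \<bullet> i) (at u) d = frechet_derivative f (at u) d \<bullet> i" if "u \<in> S" for u d
    using frechet_eq[OF has_derivative_inner_left[OF has_frechet[OF smooth_on_differentiable[OF assms(3) that]]]] by metis
  have 2: "frechet_derivative (\<lambda>u. frechet_derivative (\<lambda>u. f u \<bullet> i) (at u) d) (at x) e
     = frechet_derivative (\<lambda>u. frechet_derivative f (at u) d) (at x) e \<bullet> i" for d e
  proof -
    have "((\<lambda>u. frechet_derivative f (at u) d \<bullet> i) has_derivative
       (\<lambda>e. frechet_derivative (\<lambda>u. frechet_derivative f (at u) d) (at x) e \<bullet> i)) (at x)"
      by (rule has_derivative_inner_left[OF has_frechet[OF smooth_on_differentiable[OF smooth_on_derivative[OF assms(3)] assms(2)]]])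
    from has_derivative_transform_within_open[OF this assms(1,2)] 1
    have "((\<lambda>u. frechet_derivative (\<lambda>u. f u \<bullet> i) (at u) d) has_derivative
       (\<lambda>e. frechet_derivative (\<lambda>u. frechet_derivative f (at u) d) (at x) e \<bullet> i)) (at x)" by simp
    from frechet_eq[OF this] show ?thesis by metis
  qed
  show "frechet_derivative (\<lambda>u. frechet_derivative f (at u) d) (at x) e \<bullet> i =
         frechet_derivative (\<lambda>u. frechet_derivative f (at u) e) (at x) d \<bullet> i"
    using second_derivative_symmetric_real[OF assms(1,2) sm] 2 by metis
qed

section \<open>Charts and tangent vectors\<close>

locale atlas =
  fixes A :: "('a, 'v::euclidean_space) chart set"
  assumes smooth_atlas: "smooth_atlas A"
begin

abbreviation trans_deriv :: "('a, 'v) chart \<Rightarrow> ('a, 'v) chart \<Rightarrow> 'a \<Rightarrow> 'v \<Rightarrow> 'v" where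
  "trans_deriv c c' x \<equiv> frechet_derivative (cmap c' \<circ> cinv c) (at (cmap c x))"

lemma cinv_cmap [simp]: "c \<in> A \<Longrightarrow> x \<in> cdom c \<Longrightarrow> cinv c (cmap c x) = x"
  using smooth_atlas by (simp add: smooth_atlas_def cinv_def)

lemma cinv_in_cdom: "u \<in> cmap c ` cdom c \<Longrightarrow> cinv c u \<in> cdom c"
  unfolding cinv_def by (rule inv_into_into)

lemma cmap_cinv: "u \<in> cmap c ` cdom c \<Longrightarrow> cmap c (cinv c u) = u"
  unfolding cinv_def by (rule f_inv_into_f)

lemma open_image: "c \<in> A \<Longrightarrow> open (cmap c ` cdom c)"
  using smooth_atlas by (simp add: smooth_atlas_def)

lemma open_overlap: "c \<in> A \<Longrightarrow> c' \<in> A \<Longrightarrow> open (cmap c ` (cdom c \<inter> cdom c'))"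
  using smooth_atlas by (simp add: smooth_atlas_def)

lemma smooth_transition:
  "c \<in> A \<Longrightarrow> c' \<in> A \<Longrightarrow> smooth_on (cmap c ` (cdom c \<inter> cdom c')) (cmap c' \<circ> cinv c)"
  using smooth_atlas by (simp add: smooth_atlas_def)

lemma chart_at: "x \<in> points A \<Longrightarrow> chart_at A x \<in> A \<and> x \<in> cdom (chart_at A x)"
  unfolding chart_at_def points_def by (rule someI_ex) auto

lemma transition_differentiable:
  assumes "c \<in> A" "c' \<in> A" "x \<in> cdom c" "x \<in> cdom c'"
  shows "(cmap c' \<circ> cinv c) differentiable (at (cmap c x))"
  using smooth_on_differentiable[OF smooth_transition[OF assms(1,2)]] assms by auto

lemma transition_has_derivative:
  assumes "c \<in> A" "c' \<in> A" "x \<in> cdom c" "x \<in> cdom c'"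
  shows "((cmap c' \<circ> cinv c) has_derivative trans_deriv c c' x) (at (cmap c x))"
  by (rule has_frechet[OF transition_differentiable[OF assms]])

text \<open>Chain rule for a change of chart.\<close>

text \<open>All comparisons of two charts reduce to this chain rule, applied to a coordinate map, to the
  coordinate expression of a map between manifolds, or to a function.\<close>

lemma has_derivative_change_chart:
  assumes "c \<in> A" "c' \<in> A" "x \<in> cdom c" "x \<in> cdom c'"
    and "(F \<circ> cinv c') differentiable (at (cmap c' x))"
  shows "((F \<circ> cinv c) has_derivative
      (\<lambda>e. frechet_derivative (F \<circ> cinv c') (at (cmap c' x)) (trans_deriv c c' x e))) (at (cmap c x))"
proof -
  have "((F \<circ> cinv c') has_derivative frechet_derivative (F \<circ> cinv c') (at (cmap c' x)))
      (at ((cmap c' \<circ> cinv c) (cmap c x)))"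
    using assms by (simp add: has_frechet)
  from diff_chain_at[OF transition_has_derivative[OF assms(1-4)] this]
  have "(((F \<circ> cinv c') \<circ> (cmap c' \<circ> cinv c)) has_derivative
      (\<lambda>e. frechet_derivative (F \<circ> cinv c') (at (cmap c' x)) (trans_deriv c c' x e))) (at (cmap c x))"
    by (simp add: o_def)
  then show ?thesis
    by (rule has_derivative_transform_within_open[OF _ open_overlap[OF assms(1,2)]])
      (use assms in auto)
qed

lemma frechet_change_chart:
  assumes "c \<in> A" "c' \<in> A" "x \<in> cdom c" "x \<in> cdom c'"
    and "(F \<circ> cinv c') differentiable (at (cmap c' x))"
  shows "frechet_derivative (F \<circ> cinv c) (at (cmap c x)) e =
    frechet_derivative (F \<circ> cinv c') (at (cmap c' x)) (trans_deriv c c' x e)"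
  using frechet_eq[OF has_derivative_change_chart[OF assms]] by simp

lemma trans_deriv_self:
  assumes "c \<in> A" "x \<in> cdom c"
  shows "trans_deriv c c x e = e"
proof -
  have "((cmap c \<circ> cinv c) has_derivative (\<lambda>e. e)) (at (cmap c x))"
    by (rule has_derivative_transform_within_open[OF has_derivative_ident open_image[OF assms(1)]])
      (use assms in auto)
  then show ?thesis using frechet_eq by metis
qed

lemma trans_deriv_trans:
  assumes "c \<in> A" "c' \<in> A" "c'' \<in> A" "x \<in> cdom c" "x \<in> cdom c'" "x \<in> cdom c''"
  shows "trans_deriv c' c'' x (trans_deriv c c' x e) = trans_deriv c c'' x e"
  using frechet_change_chart[OF assms(1,2,4,5) transition_differentiable[OF assms(2,3,5,6)]] by simp

lemma linear_trans_deriv: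
  assumes "c \<in> A" "c' \<in> A" "x \<in> cdom c" "x \<in> cdom c'"
  shows "linear (trans_deriv c c' x)"
  by (rule bounded_linear.linear[OF frechet_bounded_linear[OF transition_differentiable[OF assms]]])

lemma coord_vec_apply:
  "c' \<in> A \<Longrightarrow> x \<in> cdom c' \<Longrightarrow> coord_vec A c x e c' = trans_deriv c c' x e"
  by (simp add: coord_vec_def)

lemma coord_vec_self [simp]: "c \<in> A \<Longrightarrow> x \<in> cdom c \<Longrightarrow> coord_vec A c x e c = e"
  by (simp add: coord_vec_apply trans_deriv_self)

lemma coord_vec_in_tangent_space:
  assumes "c \<in> A" "x \<in> cdom c"
  shows "coord_vec A c x e \<in> tangent_space A x"
  unfolding tangent_space_def
  using trans_deriv_trans[OF assms(1)] assms by (auto simp: coord_vec_def)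

lemma tangent_trans_deriv:
  assumes "v \<in> tangent_space A x" "c \<in> A" "c' \<in> A" "x \<in> cdom c" "x \<in> cdom c'"
  shows "trans_deriv c c' x (v c) = v c'"
proof -
  have "\<forall>c\<in>A. \<forall>c'\<in>A. x \<in> cdom c \<and> x \<in> cdom c' \<longrightarrow> v c' = trans_deriv c c' x (v c)"
    using assms(1) unfolding tangent_space_def mem_Collect_eq by (rule conjunct1)
  from this[rule_format, OF assms(2,3) conjI[OF assms(4,5)]] show ?thesis by (rule sym)
qed

lemma tangent_outside:
  assumes "v \<in> tangent_space A x" "c \<notin> A \<or> x \<notin> cdom c"
  shows "v c = 0"
proof -
  have "\<forall>c. c \<notin> A \<or> x \<notin> cdom c \<longrightarrow> v c = 0"
    using assms(1) unfolding tangent_space_def mem_Collect_eq by (rule conjunct2)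
  from this[rule_format, OF assms(2)] show ?thesis .
qed

text \<open>A tangent vector is determined by its coordinates in a single chart; with \<open>coord_vec_self\<close> this
  identifies the tangent space with the model space.\<close>

lemma tangent_eq_coord_vec:
  assumes "v \<in> tangent_space A x" "c \<in> A" "x \<in> cdom c"
  shows "v = coord_vec A c x (v c)"
proof
  fix c'
  show "v c' = coord_vec A c x (v c) c'"
  proof (cases "c' \<in> A \<and> x \<in> cdom c'")
    case True
    then show ?thesis using tangent_trans_deriv[OF assms(1,2) _ assms(3)] by (simp add: coord_vec_def)
  next
    case False
    then have "v c' = 0" by (intro tangent_outside[OF assms(1)]) auto
    then show ?thesis using False by (auto simp: coord_vec_def)
  qed
qed

lemma coord_vec_inject:
  assumes "c \<in> A" "x \<in> cdom c" "coord_vec A c x e = coord_vec A c x e'"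
  shows "e = e'"
  using coord_vec_self[OF assms(1,2)] assms(3) by metis

lemma coord_vec_change:
  assumes "c \<in> A" "c' \<in> A" "x \<in> cdom c" "x \<in> cdom c'"
  shows "coord_vec A c x e = coord_vec A c' x (trans_deriv c c' x e)"
  using tangent_eq_coord_vec[OF coord_vec_in_tangent_space[OF assms(1,3)] assms(2,4)]
    coord_vec_apply[OF assms(2,4)] by metis

lemma coord_vec_add:
  assumes "c \<in> A" "x \<in> cdom c"
  shows "coord_vec A c x (e + e') = (\<lambda>d. coord_vec A c x e d + coord_vec A c x e' d)"
  by (rule ext) (simp add: coord_vec_def linear_add[OF linear_trans_deriv[OF assms(1) _ assms(2)]])

lemma coord_vec_scale:
  assumes "c \<in> A" "x \<in> cdom c"
  shows "coord_vec A c x (r *\<^sub>R e) = (\<lambda>d. r *\<^sub>R coord_vec A c x e d)"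
  by (rule ext) (simp add: coord_vec_def linear_scale[OF linear_trans_deriv[OF assms(1) _ assms(2)]])

lemma coord_vec_zero:
  assumes "c \<in> A" "x \<in> cdom c"
  shows "coord_vec A c x 0 = (\<lambda>d. 0)"
  using coord_vec_scale[OF assms, of 0 0] by simp

lemma coord_vec_diff:
  assumes "c \<in> A" "x \<in> cdom c"
  shows "coord_vec A c x (e - e') = (\<lambda>d. coord_vec A c x e d - coord_vec A c x e' d)"
  using coord_vec_add[OF assms, of e "(-1) *\<^sub>R e'"] coord_vec_scale[OF assms, of "-1" e'] by simp

lemma tlinear_coord:
  assumes "c \<in> A" "x \<in> cdom c" "tlinear (tangent_space A x) f"
  shows "linear (\<lambda>e. f (coord_vec A c x e))"
  using assms(3) coord_vec_in_tangent_space[OF assms(1,2)]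
  by (intro linearI) (auto simp: tlinear_def coord_vec_add[OF assms(1,2)] coord_vec_scale[OF assms(1,2)])

end

section \<open>Differentials of smooth maps\<close>

text \<open>The definition of \<open>differential\<close> refers to an arbitrary chart around \<open>x\<close>; compatibility of the
  components of \<open>v\<close> allows any chart to be used instead.\<close>

lemma differential_coord:
  assumes "atlas A" "atlas B" "smooth_map A B f" "v \<in> tangent_space A x"
    and "c \<in> A" "x \<in> cdom c" "d \<in> B" "f x \<in> cdom d"
  shows "differential A B f x v d =
    frechet_derivative (cmap d \<circ> f \<circ> cinv c) (at (cmap c x)) (v c)"
proof -
  interpret A: atlas A by fact
  let ?c = "chart_at A x"
  have c: "?c \<in> A" "x \<in> cdom ?c" using A.chart_at[of x] assms(5,6) by (auto simp: points_def)
  have "(cmap d \<circ> f \<circ> cinv c) differentiable (at (cmap c x))"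
    using assms by (auto simp: smooth_map_def intro!: smooth_on_differentiable)
  from A.frechet_change_chart[OF c(1) assms(5) c(2) assms(6) this]
  have "frechet_derivative (cmap d \<circ> f \<circ> cinv ?c) (at (cmap ?c x)) (v ?c) =
     frechet_derivative (cmap d \<circ> f \<circ> cinv c) (at (cmap c x)) (A.trans_deriv ?c c x (v ?c))" .
  moreover have "A.trans_deriv ?c c x (v ?c) = v c"
    using A.tangent_trans_deriv[OF assms(4) c(1) assms(5) c(2) assms(6)] .
  ultimately show ?thesis using assms by (simp add: differential_def)
qed

lemma differential_in_tangent_space:
  assumes "atlas A" "atlas B" "smooth_map A B f" "v \<in> tangent_space A x" "x \<in> points A"
  shows "differential A B f x v \<in> tangent_space B (f x)"
proof -
  interpret A: atlas A by fact
  interpret B: atlas B by fact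
  let ?c = "chart_at A x"
  have c: "?c \<in> A" "x \<in> cdom ?c" using A.chart_at[OF assms(5)] by auto
  have "differential A B f x v d' = B.trans_deriv d d' (f x) (differential A B f x v d)"
    if d: "d \<in> B" "d' \<in> B" "f x \<in> cdom d" "f x \<in> cdom d'" for d d'
  proof -
    have op: "open (cmap ?c ` {y \<in> cdom ?c. f y \<in> cdom d})" (is "open ?S")
      and sm: "smooth_on (cmap ?c ` {y \<in> cdom ?c. f y \<in> cdom d}) (cmap d \<circ> f \<circ> cinv ?c)"
      and sm': "smooth_on (cmap ?c ` {y \<in> cdom ?c. f y \<in> cdom d'}) (cmap d' \<circ> f \<circ> cinv ?c)"
      using assms(3) c d by (auto simp: smooth_map_def)
    have op': "open (cmap ?c ` {y \<in> cdom ?c. f y \<in> cdom d'})" 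
      using assms(3) c d by (auto simp: smooth_map_def)
    have 1: "((cmap d \<circ> f \<circ> cinv ?c) has_derivative
        frechet_derivative (cmap d \<circ> f \<circ> cinv ?c) (at (cmap ?c x))) (at (cmap ?c x))"
      by (rule has_frechet[OF smooth_on_differentiable[OF sm]]) (use c d in auto)
    have 2: "((cmap d' \<circ> cinv d) has_derivative B.trans_deriv d d' (f x))
        (at ((cmap d \<circ> f \<circ> cinv ?c) (cmap ?c x)))"
      using B.transition_has_derivative[OF d] c by simp
    have "((cmap d' \<circ> f \<circ> cinv ?c) has_derivative
        (\<lambda>e. B.trans_deriv d d' (f x) (frechet_derivative (cmap d \<circ> f \<circ> cinv ?c) (at (cmap ?c x)) e)))
        (at (cmap ?c x))"
      by (rule has_derivative_transform_within_open[OF has_derivative_compose[OF 1 2] op])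
        (use c d in auto)
    from frechet_eq[OF this] show ?thesis
      using d by (simp add: differential_def)
  qed
  then show ?thesis
    unfolding tangent_space_def mem_Collect_eq
    by (intro conjI ballI allI impI) (blast, auto simp: differential_def)
qed

section \<open>Exterior derivatives of one-forms\<close>

text \<open>The coordinate vectors of one chart have variable coefficients in another. The product rule therefore
  produces an extra term with a second derivative of the coordinate change; it is symmetric in \<open>d\<close>
  and \<open>e\<close> and disappears under antisymmetrisation.\<close>

lemma (in atlas) one_form_change_chart:
  assumes "one_form A b" "c \<in> A" "c' \<in> A" "x \<in> cdom c" "x \<in> cdom c'"
  shows "cderiv c (\<lambda>y. b y (coord_vec A c y e)) x d =
     cderiv c' (\<lambda>y. b y (coord_vec A c' y (trans_deriv c c' x e))) x (trans_deriv c c' x d)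
     + b x (coord_vec A c' x (frechet_derivative (\<lambda>u. frechet_derivative (cmap c' \<circ> cinv c) (at u) e) (at (cmap c x)) d))"
proof -
  let ?O = "cmap c ` (cdom c \<inter> cdom c')"
  have O: "open ?O" "cmap c x \<in> ?O" using open_overlap assms by auto
  define \<Theta> where "\<Theta> i u = b (cinv c' u) (coord_vec A c' (cinv c' u) i)" for i u
  let ?f = "cmap c' \<circ> cinv c"
  have lin: "linear (\<lambda>e. b y (coord_vec A c' y e))" if "y \<in> cdom c'" for y
    using assms that by (intro tlinear_coord) (auto simp: one_form_def points_def)
  have \<Theta>: "(\<Theta> i has_derivative frechet_derivative (\<Theta> i) (at (cmap c' x))) (at (cmap c' x))" for i
    unfolding \<Theta>_def
    by (rule has_frechet[OF smooth_on_differentiable]) (use assms in \<open>auto simp: one_form_def\<close>)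
  have eq: "b (cinv c u) (coord_vec A c (cinv c u) e) =
      (\<Sum>i\<in>Basis. (frechet_derivative ?f (at u) e \<bullet> i) * \<Theta> i (?f u))" if "u \<in> ?O" for u
  proof -
    from that obtain y where y: "y \<in> cdom c" "y \<in> cdom c'" "u = cmap c y" by auto
    have "b y (coord_vec A c y e) = b y (coord_vec A c' y (trans_deriv c c' y e))"
      using coord_vec_change[OF assms(2,3) y(1,2)] by simp
    also have "\<dots> = (\<Sum>i\<in>Basis. (trans_deriv c c' y e \<bullet> i) *\<^sub>R b y (coord_vec A c' y i))"
      by (rule linear_basis_expansion[OF lin[OF y(2)]])
    finally show ?thesis using y assms by (simp add: \<Theta>_def)
  qed
  have D1: "((\<lambda>u. frechet_derivative ?f (at u) e) has_derivative
      frechet_derivative (\<lambda>u. frechet_derivative ?f (at u) e) (at (cmap c x))) (at (cmap c x))"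
    (is "(_ has_derivative ?D2) _")
    by (rule has_frechet[OF smooth_on_differentiable[OF smooth_on_derivative[OF smooth_transition[OF assms(2,3)]] O(2)]])
  have D2: "((\<lambda>u. \<Theta> i (?f u)) has_derivative (\<lambda>d. frechet_derivative (\<Theta> i) (at (cmap c' x)) (trans_deriv c c' x d)))
     (at (cmap c x))" for i
    using has_derivative_compose[OF transition_has_derivative[OF assms(2-5)], of "\<Theta> i"] \<Theta> assms by simp
  have "((\<lambda>u. \<Sum>i\<in>Basis. (frechet_derivative ?f (at u) e \<bullet> i) * \<Theta> i (?f u)) has_derivative
     (\<lambda>d. \<Sum>i\<in>Basis. (trans_deriv c c' x e \<bullet> i) * frechet_derivative (\<Theta> i) (at (cmap c' x)) (trans_deriv c c' x d)
        + (?D2 d \<bullet> i) * \<Theta> i (?f (cmap c x)))) (at (cmap c x))"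
    by (intro has_derivative_sum has_derivative_mult has_derivative_inner_left D1 D2)
  then have "((\<lambda>u. b (cinv c u) (coord_vec A c (cinv c u) e)) has_derivative
     (\<lambda>d. \<Sum>i\<in>Basis. (trans_deriv c c' x e \<bullet> i) * frechet_derivative (\<Theta> i) (at (cmap c' x)) (trans_deriv c c' x d)
        + (?D2 d \<bullet> i) * \<Theta> i (?f (cmap c x)))) (at (cmap c x))"
    by (rule has_derivative_transform_within_open[OF _ O]) (simp add: eq)
  from frechet_eq[OF this] have "cderiv c (\<lambda>y. b y (coord_vec A c y e)) x d =
     (\<Sum>i\<in>Basis. (trans_deriv c c' x e \<bullet> i) * frechet_derivative (\<Theta> i) (at (cmap c' x)) (trans_deriv c c' x d))
        + (\<Sum>i\<in>Basis. (?D2 d \<bullet> i) * \<Theta> i (cmap c' x))"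
    using assms by (simp add: cderiv_def o_def sum.distrib)
  moreover have "(\<Sum>i\<in>Basis. (?D2 d \<bullet> i) * \<Theta> i (cmap c' x)) = b x (coord_vec A c' x (?D2 d))"
    using linear_basis_expansion[OF lin[OF assms(5)], of "?D2 d"] assms by (simp add: \<Theta>_def)
  moreover have "(\<Sum>i\<in>Basis. (e' \<bullet> i) * frechet_derivative (\<Theta> i) (at (cmap c' x)) d') =
     cderiv c' (\<lambda>y. b y (coord_vec A c' y e')) x d'" for e' d'
  proof -
    have 1: "((\<lambda>u. \<Sum>i\<in>Basis. (e' \<bullet> i) * \<Theta> i u) has_derivative
      (\<lambda>d. \<Sum>i\<in>Basis. (e' \<bullet> i) * frechet_derivative (\<Theta> i) (at (cmap c' x)) d)) (at (cmap c' x))"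
      by (intro has_derivative_sum has_derivative_mult_right \<Theta>)
    have 2: "(\<Sum>i\<in>Basis. (e' \<bullet> i) * \<Theta> i u) = b (cinv c' u) (coord_vec A c' (cinv c' u) e')"
      if "u \<in> cmap c' ` cdom c'" for u
      using linear_basis_expansion[OF lin[OF cinv_in_cdom[OF that]], of e'] by (simp add: \<Theta>_def)
    have "((\<lambda>u. b (cinv c' u) (coord_vec A c' (cinv c' u) e')) has_derivative
      (\<lambda>d. \<Sum>i\<in>Basis. (e' \<bullet> i) * frechet_derivative (\<Theta> i) (at (cmap c' x)) d)) (at (cmap c' x))"
      by (rule has_derivative_transform_within_open[OF 1 open_image[OF assms(3)] _ 2]) (use assms in auto)
    from frechet_eq[OF this] show ?thesis by (simp add: cderiv_def o_def)
  qed
  ultimately show ?thesis by simp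
qed

lemma (in atlas) ext_deriv1_chart:
  assumes "one_form A b" "c \<in> A" "x \<in> cdom c" "v \<in> tangent_space A x" "w \<in> tangent_space A x"
  shows "ext_deriv1 A b x v w = cderiv c (\<lambda>y. b y (coord_vec A c y (w c))) x (v c)
     - cderiv c (\<lambda>y. b y (coord_vec A c y (v c))) x (w c)"
proof -
  let ?c = "chart_at A x"
  have c: "?c \<in> A" "x \<in> cdom ?c" using chart_at[of x] assms(2,3) by (auto simp: points_def)
  have tr: "trans_deriv ?c c x (v ?c) = v c" "trans_deriv ?c c x (w ?c) = w c"
    using tangent_trans_deriv[OF _ c(1) assms(2) c(2) assms(3)] assms by auto
  have "frechet_derivative (\<lambda>u. frechet_derivative (cmap c \<circ> cinv ?c) (at u) e) (at (cmap ?c x)) d =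
     frechet_derivative (\<lambda>u. frechet_derivative (cmap c \<circ> cinv ?c) (at u) d) (at (cmap ?c x)) e" for d e
    by (rule second_derivative_symmetric[OF open_overlap[OF c(1) assms(2)] _ smooth_transition[OF c(1) assms(2)]])
      (use c assms in auto)
  from this[of "w ?c" "v ?c"] show ?thesis
    unfolding ext_deriv1_def Let_def
    using one_form_change_chart[OF assms(1) c(1) assms(2) c(2) assms(3), of "w ?c" "v ?c"]
      one_form_change_chart[OF assms(1) c(1) assms(2) c(2) assms(3), of "v ?c" "w ?c"]
    by (simp only: tr)
qed

section \<open>Linear algebra\<close>

text \<open>Expansion of a linear map in the coordinate directions \<open>\<partial>/\<partial>y\<^sup>i\<close>, \<open>\<partial>/\<partial>q\<^sup>\<gamma>\<close>.\<close>

lemma linear_yq_expansion: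
  fixes f :: "('y::finite, 'q::finite) yq \<Rightarrow> 'w::real_vector"
  assumes "linear f"
  shows "f (a, t) = (\<Sum>i\<in>UNIV. a $ i *\<^sub>R f (axis i 1, 0)) + (\<Sum>\<gamma>\<in>UNIV. t $ \<gamma> *\<^sub>R f (0, axis \<gamma> 1))"
proof -
  have "a = (\<Sum>i\<in>UNIV. a $ i *\<^sub>R axis i 1)" "t = (\<Sum>\<gamma>\<in>UNIV. t $ \<gamma> *\<^sub>R axis \<gamma> 1)"
    using basis_expansion[of a] basis_expansion[of t] by (simp_all add: scalar_mult_eq_scaleR)
  then have eq: "(a, t) = (\<Sum>i\<in>UNIV. a $ i *\<^sub>R (axis i 1, 0)) + (\<Sum>\<gamma>\<in>UNIV. t $ \<gamma> *\<^sub>R (0, axis \<gamma> 1))"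
    by (simp add: prod_eq_iff fst_sum snd_sum)
  show ?thesis
    by (subst eq) (simp only: linear_add[OF assms] linear_sum[OF assms] linear_scale[OF assms])
qed

lemma inner_matrix_vector_mult:
  fixes W :: "real^'n^'m"
  shows "a \<bullet> (W *v a') = (\<Sum>i\<in>UNIV. \<Sum>j\<in>UNIV. a $ i * a' $ j * W $ i $ j)"
  by (simp add: inner_vec_def matrix_vector_mult_def sum_distrib_left mult_ac)

lemma sum_mult_neg_affine:
  fixes a B D :: "'i \<Rightarrow> real"
  shows "(\<Sum>j\<in>I. a j * - (B j * P + D j)) = - ((\<Sum>j\<in>I. a j * B j) * P + (\<Sum>j\<in>I. a j * D j))"
  by (simp add: algebra_simps sum.distrib sum_negf sum_distrib_left sum_subtractf)

lemma sum_mult_neg: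
  fixes a B :: "'i \<Rightarrow> real"
  shows "(\<Sum>j\<in>I. a j * - (B j * P)) = - ((\<Sum>j\<in>I. a j * B j) * P)"
  by (simp add: sum_negf sum_distrib_right mult.assoc)

lemma sum_axis_scaleR:
  fixes f :: "'i::finite \<Rightarrow> 'w::real_vector"
  shows "(\<Sum>i\<in>UNIV. axis j (1::real) $ i *\<^sub>R f i) = f j"
proof -
  have "axis j (1::real) $ i *\<^sub>R f i = (if i = j then f i else 0)" for i
    by (simp add: axis_def)
  then show ?thesis by simp
qed

lemma matrix_inv_works:
  fixes W :: "real^'n^'n"
  assumes "invertible W"
  shows "W ** matrix_inv W = mat 1" "matrix_inv W ** W = mat 1"
  using someI_ex[OF assms[unfolded invertible_def]] unfolding matrix_inv_def by auto

text \<open>\<open>V\<^sup>T = V\<^sup>T W V = - (V\<^sup>T W\<^sup>T) V = - V\<close> for the inverse \<open>V\<close> of \<open>W\<close>.\<close>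

lemma skew_inverse:
  fixes W :: "real^'n^'n"
  assumes "transpose W = - W" "invertible W"
  shows "transpose (matrix_inv W) = - matrix_inv W"
proof -
  let ?V = "matrix_inv W"
  have WV: "W ** ?V = mat 1" "?V ** W = mat 1"
    by (rule matrix_inv_works[OF assms(2)])+
  have neg: "X ** (- Y) = - (X ** Y)" "(- X) ** Y = - (X ** Y)" for X Y :: "real^'n^'n"
    by (simp_all add: matrix_matrix_mult_def vec_eq_iff sum_negf)
  have "transpose ?V = transpose ?V ** (W ** ?V)" by (simp add: WV)
  also have "\<dots> = - (transpose ?V ** transpose W ** ?V)" by (simp add: assms(1) neg matrix_mul_assoc)
  also have "transpose ?V ** transpose W = mat 1" by (simp add: WV transpose_mat flip: matrix_transpose_mul)
  finally show ?thesis by simp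
qed

text \<open>The transpose matches the index convention of \<open>omega_tilde_inv\<close>.\<close>

lemma matrix_triple_component:
  fixes N :: "real^'q^'y" and V :: "real^'y^'y"
  shows "(transpose N ** V ** N) $ \<beta> $ \<alpha> = (\<Sum>i\<in>UNIV. \<Sum>j\<in>UNIV. N $ i $ \<alpha> * transpose V $ i $ j * N $ j $ \<beta>)"
  by (simp add: matrix_matrix_mult_def transpose_def sum_distrib_right sum_distrib_left mult_ac)

text \<open>The pointwise core of the theorem. In a space with the form \<open>W(a, a') - \<rho> \<cdot> \<tau>' + \<rho>' \<cdot> \<tau>\<close>, the
  premise says that \<open>(a, \<tau>, \<rho>)\<close> is orthogonal to the subspace \<open>\<rho>' = N\<^sup>T a' + M\<^sup>T \<tau>'\<close>. Since \<open>a'\<close> and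
  \<open>\<tau>'\<close> are free, this determines \<open>a\<close> and \<open>\<rho>\<close> from \<open>\<tau>\<close>, and substitution into the conclusion leaves an
  identity of matrices.\<close>

lemma coisotropic_graph_linear:
  fixes W :: "real^'y^'y" and N :: "real^'q^'y" and M :: "real^'q^'q"
  assumes skew: "transpose W = - W" and inv: "invertible W"
  shows "(\<forall>a \<tau> \<rho>. (\<forall>a' \<tau>'. a \<bullet> (W *v a') - \<rho> \<bullet> \<tau>' + (a' v* N + \<tau>' v* M) \<bullet> \<tau> = 0) \<longrightarrow> \<rho> = a v* N + \<tau> v* M)
    \<longleftrightarrow> transpose N ** matrix_inv W ** N = M - transpose M"
proof -
  let ?V = "matrix_inv W"
  have WV: "W *v (?V *v y) = y" "?V *v (W *v y) = y" for y
    using matrix_inv_works[OF inv] by (simp_all add: matrix_vector_mul_assoc)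
  have T: "x v* B = transpose B *v x" for x and B :: "real^'c^'d" by simp
  have tW: "a \<bullet> (W *v a') = - (W *v a) \<bullet> a'" for a a'
  proof -
    have "a v* W = (- W) *v a" by (simp only: skew[symmetric] transpose_matrix_vector)
    also have "\<dots> = - (W *v a)" by (simp add: matrix_vector_mult_def vec_eq_iff sum_negf)
    finally show ?thesis by (simp flip: dot_lmul_matrix)
  qed
  have orth: "(\<forall>a' \<tau>'. a \<bullet> (W *v a') - \<rho> \<bullet> \<tau>' + (a' v* N + \<tau>' v* M) \<bullet> \<tau> = 0) \<longleftrightarrow>
      a = ?V *v (N *v \<tau>) \<and> \<rho> = M *v \<tau>" for a \<tau> \<rho>
  proof -
    have "a \<bullet> (W *v a') - \<rho> \<bullet> \<tau>' + (a' v* N + \<tau>' v* M) \<bullet> \<tau> =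
        a' \<bullet> (N *v \<tau> - W *v a) + \<tau>' \<bullet> (M *v \<tau> - \<rho>)" for a' \<tau>'
      using inner_commute[of "W *v a" a'] inner_commute[of \<rho> \<tau>']
      unfolding tW[of a a'] inner_add_left dot_lmul_matrix inner_diff_right by simp
    then have "(\<forall>a' \<tau>'. a \<bullet> (W *v a') - \<rho> \<bullet> \<tau>' + (a' v* N + \<tau>' v* M) \<bullet> \<tau> = 0) \<longleftrightarrow>
        (\<forall>a' \<tau>'. a' \<bullet> (N *v \<tau> - W *v a) + \<tau>' \<bullet> (M *v \<tau> - \<rho>) = 0)" by simp
    also have "\<dots> \<longleftrightarrow> N *v \<tau> - W *v a = 0 \<and> M *v \<tau> - \<rho> = 0"
    proof safe
      assume *: "\<forall>a' \<tau>'. a' \<bullet> (N *v \<tau> - W *v a) + \<tau>' \<bullet> (M *v \<tau> - \<rho>) = 0"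
      from *[rule_format, of "N *v \<tau> - W *v a" 0] show "N *v \<tau> - W *v a = 0" by simp
      from *[rule_format, of 0 "M *v \<tau> - \<rho>"] show "M *v \<tau> - \<rho> = 0" by simp
    qed auto
    also have "\<dots> \<longleftrightarrow> a = ?V *v (N *v \<tau>) \<and> \<rho> = M *v \<tau>"
      using WV by (metis right_minus_eq)
    finally show ?thesis .
  qed
  have "(\<forall>a \<tau> \<rho>. (\<forall>a' \<tau>'. a \<bullet> (W *v a') - \<rho> \<bullet> \<tau>' + (a' v* N + \<tau>' v* M) \<bullet> \<tau> = 0) \<longrightarrow> \<rho> = a v* N + \<tau> v* M)
    \<longleftrightarrow> (\<forall>\<tau>. M *v \<tau> = (?V *v (N *v \<tau>)) v* N + \<tau> v* M)"
    unfolding orth by blast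
  also have "\<dots> \<longleftrightarrow> (\<forall>\<tau>. (transpose N ** ?V ** N) *v \<tau> = (M - transpose M) *v \<tau>)"
    unfolding T by (auto simp: matrix_vector_mult_diff_rdistrib eq_diff_eq diff_eq_eq simp flip: matrix_vector_mul_assoc)
  also have "\<dots> \<longleftrightarrow> transpose N ** ?V ** N = M - transpose M"
    by (metis matrix_eq)
  finally show ?thesis .
qed

text \<open>The wedge products of the coframe only see the antisymmetric part of their coefficients. The factor
  \<open>1/2\<close> compensates for the fact that \<open>K\<close> is already antisymmetric.\<close>

lemma wedge_sum_eq_iff:
  fixes K M :: "'n::finite \<Rightarrow> 'n \<Rightarrow> real"
  assumes skew: "\<And>\<alpha> \<beta>. K \<alpha> \<beta> = - K \<beta> \<alpha>"
  shows "(\<forall>t t' :: real^'n. (\<Sum>\<alpha>\<in>UNIV. \<Sum>\<beta>\<in>UNIV. 1/2 * K \<alpha> \<beta> * (t $ \<alpha> * t' $ \<beta> - t' $ \<alpha> * t $ \<beta>)) =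
        (\<Sum>\<alpha>\<in>UNIV. \<Sum>\<beta>\<in>UNIV. M \<beta> \<alpha> * (t $ \<alpha> * t' $ \<beta> - t' $ \<alpha> * t $ \<beta>)))
     \<longleftrightarrow> (\<forall>\<alpha> \<beta>. K \<alpha> \<beta> = M \<beta> \<alpha> - M \<alpha> \<beta>)" (is "?L \<longleftrightarrow> ?R")
proof -
  have exp: "(\<Sum>\<alpha>\<in>UNIV. \<Sum>\<beta>\<in>UNIV. C \<alpha> \<beta> * (t $ \<alpha> * t' $ \<beta> - t' $ \<alpha> * t $ \<beta>)) =
      (\<Sum>\<alpha>\<in>UNIV. \<Sum>\<beta>\<in>UNIV. (C \<alpha> \<beta> - C \<beta> \<alpha>) * (t $ \<alpha> * t' $ \<beta>))"
    for C :: "'n \<Rightarrow> 'n \<Rightarrow> real" and t t' :: "real^'n"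
  proof -
    have "(\<Sum>\<alpha>\<in>UNIV. \<Sum>\<beta>\<in>UNIV. C \<beta> \<alpha> * (t $ \<alpha> * t' $ \<beta>)) = (\<Sum>\<alpha>\<in>UNIV. \<Sum>\<beta>\<in>UNIV. C \<alpha> \<beta> * (t $ \<beta> * t' $ \<alpha>))"
      by (rule sum.swap)
    then show ?thesis by (simp add: left_diff_distrib right_diff_distrib sum_subtractf mult.commute)
  qed
  have K: "1/2 * K \<alpha> \<beta> - 1/2 * K \<beta> \<alpha> = K \<alpha> \<beta>" for \<alpha> \<beta> using skew[of \<alpha> \<beta>] by simp
  show ?thesis
  proof
    assume ?R
    then show ?L unfolding exp K by simp
  next
    assume L: ?L
    show ?R
    proof (intro allI)
      fix \<alpha> \<beta>
      have ax: "(\<Sum>\<gamma>\<in>UNIV. \<Sum>\<delta>\<in>UNIV. C \<gamma> \<delta> * (axis \<alpha> 1 $ \<gamma> * axis \<beta> 1 $ \<delta>)) = C \<alpha> \<beta>" for C :: "'n \<Rightarrow> 'n \<Rightarrow> real"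
        by (simp add: axis_def if_distrib[of "\<lambda>r. _ * r"] if_distrib[of "\<lambda>r. r * _"] cong: if_cong)
      show "K \<alpha> \<beta> = M \<beta> \<alpha> - M \<alpha> \<beta>"
        using L[rule_format, of "axis \<alpha> 1" "axis \<beta> 1"] unfolding exp K ax .
    qed
  qed
qed

section \<open>Splittings in foliation coordinates\<close>

locale foliated_splitting = atlas A
  for A :: "('a, ('y::finite, 'q::finite) yq) chart set" +
  fixes \<omega> :: "('a, ('y, 'q) yq) two_field"
    and b :: "('a, ('y, 'q) yq) one_field"
    and G :: "('a, ('y, 'q) yq) distribution"
  assumes two_form: "two_form A \<omega>"
    and one_form: "one_form A b"
    and splitting: "splitting A \<omega> G"
begin

abbreviation E where "E \<equiv> ker_form A \<omega>"
abbreviation FC where "FC \<equiv> foliation_charts A \<omega>"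
abbreviation DA where "DA \<equiv> dual_atlas A \<omega>"
abbreviation lift where "lift \<equiv> lift_chart A \<omega>"
abbreviation R where "R \<equiv> R_coef A G"

lemma foliation_chart: "c \<in> FC \<Longrightarrow> c \<in> A"
  by (simp add: foliation_charts_def)

lemma in_points: "c \<in> FC \<Longrightarrow> x \<in> cdom c \<Longrightarrow> x \<in> points A"
  unfolding points_def using foliation_chart by blast

lemma E_eq: "c \<in> FC \<Longrightarrow> x \<in> cdom c \<Longrightarrow> E x = range (\<lambda>t. coord_vec A c x (0, t))"
  by (simp add: foliation_charts_def)

lemma coord_vec_in_E_iff:
  assumes "c \<in> FC" "x \<in> cdom c"
  shows "coord_vec A c x e \<in> E x \<longleftrightarrow> fst e = 0"
proof
  assume "coord_vec A c x e \<in> E x"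
  then obtain t where "coord_vec A c x e = coord_vec A c x (0, t)" using E_eq[OF assms] by auto
  then show "fst e = 0" using coord_vec_inject[OF foliation_chart[OF assms(1)] assms(2)] by fastforce
next
  assume "fst e = 0"
  then have "e = (0, snd e)" by (simp add: prod_eq_iff)
  then show "coord_vec A c x e \<in> E x" using E_eq[OF assms] by (metis rangeI)
qed

lemma splitting_at:
  assumes "x \<in> points A"
  shows "tsubspace (G x)" "G x \<subseteq> tangent_space A x" "G x \<inter> E x = {\<lambda>c. 0}"
    "v \<in> tangent_space A x \<Longrightarrow> \<exists>w\<in>E x. (\<lambda>c. v c - w c) \<in> G x"
  using splitting assms unfolding splitting_def by blast+

lemma G_scale: "x \<in> points A \<Longrightarrow> v \<in> G x \<Longrightarrow> (\<lambda>c. r *\<^sub>R v c) \<in> G x"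
  and G_add: "x \<in> points A \<Longrightarrow> v \<in> G x \<Longrightarrow> w \<in> G x \<Longrightarrow> (\<lambda>c. v c + w c) \<in> G x"
  and G_zero: "x \<in> points A \<Longrightarrow> (\<lambda>c. 0) \<in> G x"
  using splitting_at(1)[of x] by (auto simp: tsubspace_def)

text \<open>Two such vectors differ by an element of \<open>E\<close>, and \<open>G \<inter> E = 0\<close>.\<close>

lemma G_unique:
  assumes "c \<in> FC" "x \<in> cdom c" "coord_vec A c x (a, t) \<in> G x" "coord_vec A c x (a, t') \<in> G x"
  shows "t = t'"
proof -
  note c = foliation_chart[OF assms(1)] assms(2) and x = in_points[OF assms(1,2)]
  have "coord_vec A c x ((a, t) + (-1) *\<^sub>R (a, t')) \<in> G x"
    unfolding coord_vec_add[OF c] coord_vec_scale[OF c] by (intro G_add G_scale x assms)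
  then have "coord_vec A c x (0, t - t') \<in> G x" by simp
  moreover have "coord_vec A c x (0, t - t') \<in> E x" using coord_vec_in_E_iff[OF assms(1,2)] by simp
  ultimately have "coord_vec A c x (0, t - t') = (\<lambda>c. 0)" using splitting_at(3)[OF x] by blast
  then have "(0::real^'y, t - t') = 0" using coord_vec_zero[OF c] coord_vec_inject[OF c] by metis
  then show ?thesis by (simp add: zero_prod_def)
qed

lemma R_in_G:
  assumes "c \<in> FC" "x \<in> cdom c"
  shows "coord_vec A c x (axis i 1, R c i x) \<in> G x"
proof -
  note c = foliation_chart[OF assms(1)] assms(2) and x = in_points[OF assms(1,2)]
  obtain w where "w \<in> E x" "(\<lambda>d. coord_vec A c x (axis i 1, 0) d - w d) \<in> G x"
    using splitting_at(4)[OF x coord_vec_in_tangent_space[OF c]] by blast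
  moreover then obtain t where "w = coord_vec A c x (0, t)" using E_eq[OF assms] by auto
  ultimately have "coord_vec A c x ((axis i 1, 0) - (0, t)) \<in> G x" unfolding coord_vec_diff[OF c] by simp
  then have "coord_vec A c x (axis i 1, - t) \<in> G x" by simp
  then show ?thesis
    unfolding R_coef_def by (rule theI) (use G_unique[OF assms] \<open>coord_vec A c x (axis i 1, - t) \<in> G x\<close> in blast)
qed

text \<open>The vector of \<open>G\<close> over the \<open>y\<close>-coordinates \<open>a\<close> has the \<open>q\<close>-coordinates \<open>hor c x a\<close>.\<close>

definition hor :: "('a, ('y, 'q) yq) chart \<Rightarrow> 'a \<Rightarrow> real^'y \<Rightarrow> real^'q" where
  "hor c x a = (\<Sum>i\<in>UNIV. a $ i *\<^sub>R R c i x)"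

lemma linear_hor: "linear (hor c x)"
  by (intro linearI) (auto simp: hor_def algebra_simps sum.distrib scaleR_sum_right)

lemma hor_axis [simp]: "hor c x (axis i 1) = R c i x"
  by (simp add: hor_def axis_def if_distrib[of "\<lambda>r. r *\<^sub>R _"] cong: if_cong)

lemma hor_in_G:
  assumes "c \<in> FC" "x \<in> cdom c"
  shows "coord_vec A c x (a, hor c x a) \<in> G x"
proof -
  note c = foliation_chart[OF assms(1)] assms(2) and x = in_points[OF assms(1,2)]
  have "coord_vec A c x (\<Sum>i\<in>I. a $ i *\<^sub>R (axis i 1, R c i x)) \<in> G x" if "finite I" for I
    using that
  proof (induction I rule: finite_induct)
    case empty
    then show ?case by (simp add: coord_vec_zero[OF c] G_zero[OF x] del: zero_prod_def)
  next
    case (insert i I)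
    show ?case
      unfolding sum.insert[OF insert.hyps] coord_vec_add[OF c] coord_vec_scale[OF c]
      by (intro G_add G_scale x R_in_G assms insert.IH)
  qed
  from this[OF finite] have "coord_vec A c x (\<Sum>i\<in>UNIV. a $ i *\<^sub>R (axis i 1, R c i x)) \<in> G x" .
  moreover have "(\<Sum>i\<in>UNIV. a $ i *\<^sub>R (axis i 1, R c i x)) = (a, hor c x a)"
    using basis_expansion[of a] by (simp add: prod_eq_iff fst_sum snd_sum hor_def scalar_mult_eq_scaleR)
  ultimately show ?thesis by simp
qed

text \<open>Subtracting the vector \<open>(a, hor a)\<close> of \<open>G\<close> from \<open>(a, t)\<close> leaves a vector tangent to the leaf.\<close>

lemma proj_along_coord:
  assumes "c \<in> FC" "x \<in> cdom c"
  shows "proj_along A \<omega> G x (coord_vec A c x e) = coord_vec A c x (0, snd e - hor c x (fst e))"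
  unfolding proj_along_def
proof (rule the_equality)
  note c = foliation_chart[OF assms(1)] assms(2)
  have "(\<lambda>d. coord_vec A c x e d - coord_vec A c x (0, snd e - hor c x (fst e)) d) \<in> G x"
    using hor_in_G[OF assms, of "fst e"] unfolding coord_vec_diff[OF c, symmetric]
    by (cases e) simp
  then show "coord_vec A c x (0, snd e - hor c x (fst e)) \<in> E x \<and>
      (\<lambda>d. coord_vec A c x e d - coord_vec A c x (0, snd e - hor c x (fst e)) d) \<in> G x"
    using coord_vec_in_E_iff[OF assms] by simp
  fix w assume w: "w \<in> E x \<and> (\<lambda>d. coord_vec A c x e d - w d) \<in> G x"
  then obtain t where t: "w = coord_vec A c x (0, t)" using E_eq[OF assms] by auto
  with w have "coord_vec A c x (e - (0, t)) \<in> G x" unfolding coord_vec_diff[OF c] by simp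
  then have "coord_vec A c x (fst e, snd e - t) \<in> G x" by (cases e) simp
  from G_unique[OF assms this hor_in_G[OF assms]] have "t = snd e - hor c x (fst e)"
    by (simp add: algebra_simps)
  then show "w = coord_vec A c x (0, snd e - hor c x (fst e))" using t by simp
qed

text \<open>The projection of \<open>\<partial>/\<partial>y\<^sup>i\<close> to \<open>E\<close> along \<open>G\<close> is \<open>- R\<^sub>i\<^sup>\<alpha> \<partial>/\<partial>q\<^sup>\<alpha>\<close>, and this projection is smooth.\<close>

lemma smooth_R:
  assumes "c \<in> FC"
  shows "smooth_on (cmap c ` cdom c) (\<lambda>u. R c i (cinv c u))"
proof -
  note c = foliation_chart[OF assms]
  have "smooth_on (cmap c ` cdom c)
     (\<lambda>u. proj_along A \<omega> G (cinv c u) (coord_vec A c (cinv c u) (axis i 1, 0)) c)"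
    using splitting c unfolding splitting_def by blast
  from smooth_on_linear_compose[OF open_image[OF c] bounded_linear_minus[OF bounded_linear_snd] this]
  show ?thesis
    by (rule smooth_on_cong[OF open_image[OF c], rotated])
      (simp add: proj_along_coord[OF assms cinv_in_cdom] coord_vec_self[OF c cinv_in_cdom])
qed

section \<open>The dual bundle of the null foliation\<close>

lemma coord_vec_q:
  assumes "c \<in> FC" "z \<in> leaf_dual A \<omega>" "fst z \<in> cdom c"
  shows "snd z (coord_vec A c (fst z) (0, t)) = p_coord A c z \<bullet> t"
proof -
  note c = foliation_chart[OF assms(1)] assms(3)
  have tl: "tlinear (E (fst z)) (snd z)" using assms(2) by (auto simp: leaf_dual_def)
  have "coord_vec A c (fst z) (0, t) \<in> E (fst z)" for t
    using coord_vec_in_E_iff[OF assms(1,3)] by simp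
  then have "linear (\<lambda>t. snd z (coord_vec A c (fst z) (0, t)))"
    using tl coord_vec_add[OF c, of "(0, _)" "(0, _)"] coord_vec_scale[OF c, of _ "(0, _)"]
    by (intro linearI) (auto simp: tlinear_def)
  from linear_sum[OF this, of "\<lambda>\<beta>. t $ \<beta> *\<^sub>R axis \<beta> 1" UNIV] linear_scale[OF this]
  show ?thesis
    using basis_expansion[of t]
    by (simp add: scalar_mult_eq_scaleR p_coord_def inner_vec_def mult.commute)
qed

text \<open>The point of \<open>E\<^sup>*\<close> over \<open>x\<close> with fibre coordinates \<open>p\<close>; this is the inverse of the induced chart
  (lemma \<open>cinv_lift\<close>).\<close>

definition covec :: "('a, ('y, 'q) yq) chart \<Rightarrow> 'a \<Rightarrow> real^'q \<Rightarrow> ('a, ('y, 'q) yq) covector" where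
  "covec c x p = (x, \<lambda>v. if v \<in> E x then p \<bullet> snd (v c) else 0)"

lemma fst_covec [simp]: "fst (covec c x p) = x" by (simp add: covec_def)

lemma cdom_lift: "cdom (lift c) = {z \<in> leaf_dual A \<omega>. fst z \<in> cdom c}"
  and cmap_lift: "cmap (lift c) z = (cmap c (fst z), p_coord A c z)"
  by (simp_all add: lift_chart_def)

lemma covec_in_lift:
  assumes "c \<in> FC" "x \<in> cdom c"
  shows "covec c x p \<in> cdom (lift c)" "p_coord A c (covec c x p) = p"
proof -
  note c = foliation_chart[OF assms(1)] assms(2)
  have "(\<lambda>d. v d + w d) \<in> E x" "(\<lambda>d. r *\<^sub>R v d) \<in> E x" if "v \<in> E x" "w \<in> E x" for v w r
  proof -
    from that obtain t t' where t: "v = coord_vec A c x (0, t)" "w = coord_vec A c x (0, t')"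
      using E_eq[OF assms] by auto
    show "(\<lambda>d. v d + w d) \<in> E x" "(\<lambda>d. r *\<^sub>R v d) \<in> E x"
      unfolding t coord_vec_add[OF c, symmetric] coord_vec_scale[OF c, symmetric]
      by (simp_all add: coord_vec_in_E_iff[OF assms])
  qed
  then have "tlinear (E x) (\<lambda>v. if v \<in> E x then p \<bullet> snd (v c) else 0)"
    by (auto simp: tlinear_def inner_add_right)
  then show "covec c x p \<in> cdom (lift c)"
    using in_points[OF assms] assms by (auto simp: cdom_lift leaf_dual_def covec_def)
  show "p_coord A c (covec c x p) = p"
    using c by (simp add: vec_eq_iff p_coord_def covec_def coord_vec_in_E_iff[OF assms] inner_axis)
qed

lemma covec_p_coord:
  assumes "c \<in> FC" "z \<in> cdom (lift c)"
  shows "covec c (fst z) (p_coord A c z) = z"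
proof -
  have z: "z \<in> leaf_dual A \<omega>" "fst z \<in> cdom c" using assms(2) by (auto simp: cdom_lift)
  note c = foliation_chart[OF assms(1)] z(2)
  have "snd z v = (if v \<in> E (fst z) then p_coord A c z \<bullet> snd (v c) else 0)" for v
  proof (cases "v \<in> E (fst z)")
    case True
    then obtain t where "v = coord_vec A c (fst z) (0, t)" using E_eq[OF assms(1) z(2)] by auto
    then show ?thesis using True coord_vec_q[OF assms(1) z] c by simp
  next
    case False
    then show ?thesis using z(1) by (auto simp: leaf_dual_def)
  qed
  then have "snd z = (\<lambda>v. if v \<in> E (fst z) then p_coord A c z \<bullet> snd (v c) else 0)" by (rule ext)
  then show ?thesis unfolding covec_def by (metis prod.collapse)
qed

lemma lift_image:
  assumes "c \<in> FC" "W \<subseteq> cdom c"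
  shows "cmap (lift c) ` {z \<in> leaf_dual A \<omega>. fst z \<in> W} = (cmap c ` W) \<times> UNIV"
proof (intro equalityI subsetI)
  fix w assume "w \<in> (cmap c ` W) \<times> (UNIV :: (real^'q) set)"
  then obtain x p where x: "x \<in> W" "w = (cmap c x, p)" by auto
  then have "x \<in> cdom c" using assms(2) by blast
  from covec_in_lift[OF assms(1) this] show "w \<in> cmap (lift c) ` {z \<in> leaf_dual A \<omega>. fst z \<in> W}"
    using x by (intro image_eqI[of _ _ "covec c x p"]) (auto simp: cmap_lift cdom_lift)
qed (auto simp: cmap_lift)

lemma inj_on_lift:
  assumes "c \<in> FC"
  shows "inj_on (cmap (lift c)) (cdom (lift c))"
proof (rule inj_onI)
  fix z z' assume z: "z \<in> cdom (lift c)" "z' \<in> cdom (lift c)" "cmap (lift c) z = cmap (lift c) z'"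
  then have "cinv c (cmap c (fst z)) = cinv c (cmap c (fst z'))" by (simp add: cmap_lift)
  then have "fst z = fst z'"
    using z foliation_chart[OF assms] by (simp add: cdom_lift)
  moreover have "p_coord A c z = p_coord A c z'" using z(3) by (simp add: cmap_lift)
  ultimately show "z = z'"
    using covec_p_coord[OF assms z(1)] covec_p_coord[OF assms z(2)] by metis
qed

lemma cinv_lift:
  assumes "c \<in> FC" "fst w \<in> cmap c ` cdom c"
  shows "cinv (lift c) w = covec c (cinv c (fst w)) (snd w)"
proof -
  have "cmap (lift c) (covec c (cinv c (fst w)) (snd w)) = w"
    using covec_in_lift[OF assms(1) cinv_in_cdom[OF assms(2)]] cmap_cinv[OF assms(2)]
    by (simp add: cmap_lift)
  then show ?thesis
    using inv_into_f_f[OF inj_on_lift[OF assms(1)] covec_in_lift(1)[OF assms(1) cinv_in_cdom[OF assms(2)]]]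
    unfolding cinv_def by metis
qed

text \<open>Vectors tangent to the leaves have vanishing \<open>y\<close>-coordinates in both charts, so the fibre coordinates
  change by the transposed leafwise Jacobian.\<close>

lemma p_coord_change:
  assumes "c \<in> FC" "c' \<in> FC" "z \<in> leaf_dual A \<omega>" "fst z \<in> cdom c" "fst z \<in> cdom c'"
  shows "p_coord A c' z = (\<chi> \<beta>. p_coord A c z \<bullet> snd (trans_deriv c' c (fst z) (0, axis \<beta> 1)))"
proof -
  have "snd z (d_q A c' (fst z) \<beta>) = p_coord A c z \<bullet> snd (trans_deriv c' c (fst z) (0, axis \<beta> 1))" for \<beta>
  proof -
    let ?e = "trans_deriv c' c (fst z) (0, axis \<beta> 1)"
    have eq: "d_q A c' (fst z) \<beta> = coord_vec A c (fst z) ?e"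
      using assms foliation_chart by (intro coord_vec_change) auto
    have "d_q A c' (fst z) \<beta> \<in> E (fst z)" using coord_vec_in_E_iff[OF assms(2,5)] by simp
    then have "fst ?e = 0" unfolding eq using coord_vec_in_E_iff[OF assms(1,4)] by blast
    then have "?e = (0, snd ?e)" by (simp add: prod_eq_iff)
    then show ?thesis unfolding eq using coord_vec_q[OF assms(1,3,4)] by metis
  qed
  then show ?thesis by (simp add: p_coord_def[of A c'])
qed

text \<open>Fibre coordinates transform linearly, with coefficients that are first derivatives of a smooth
  coordinate change.\<close>

lemma lift_transition_smooth:
  assumes "c \<in> FC" "c' \<in> FC"
  shows "smooth_on ((cmap c ` (cdom c \<inter> cdom c')) \<times> UNIV) (cmap (lift c') \<circ> cinv (lift c))"
proof -
  let ?S = "cmap c ` (cdom c \<inter> cdom c')"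
  let ?S' = "cmap c' ` (cdom c \<inter> cdom c')"
  let ?f = "cmap c' \<circ> cinv c"
  note c = foliation_chart[OF assms(1)] and c' = foliation_chart[OF assms(2)]
  have op: "open ?S" "open ?S'" using open_overlap[OF c c'] open_overlap[OF c' c] by (simp_all add: Int_commute)
  then have op2: "open (?S \<times> (UNIV :: (real^'q) set))" by (simp add: open_Times)
  have sf: "smooth_on ?S ?f" by (rule smooth_transition[OF c c'])
  have sg: "smooth_on ?S' (\<lambda>u. frechet_derivative (cmap c \<circ> cinv c') (at u) e)" for e
    using smooth_on_derivative[OF smooth_transition[OF c' c]] by (simp add: Int_commute)
  have "?f ` ?S \<subseteq> ?S'" using c by auto
  then have "smooth_on ?S (\<lambda>u. frechet_derivative (cmap c \<circ> cinv c') (at (?f u)) e)" for e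
    by (rule smooth_on_compose[OF op _ sf sg])
  then have "smooth_on ?S (\<lambda>u. snd (frechet_derivative (cmap c \<circ> cinv c') (at (?f u)) e))" for e
    by (rule smooth_on_linear_compose[OF op(1) bounded_linear_snd])
  then have "smooth_on (?S \<times> UNIV) (\<lambda>w. (?f (fst w),
      \<chi> \<beta>. snd w \<bullet> snd (frechet_derivative (cmap c \<circ> cinv c') (at (?f (fst w))) (0, axis \<beta> 1))))"
    by (intro smooth_on_Pair op2 smooth_on_vec_lambda smooth_on_bilinear[OF op2 bounded_bilinear_inner]
        smooth_on_bounded_linear[OF op2 bounded_linear_snd] smooth_on_compose_fst[OF op(1)] sf)
  then show ?thesis
  proof (rule smooth_on_cong[OF op2, rotated])
    fix w assume "w \<in> ?S \<times> (UNIV :: (real^'q) set)"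
    then obtain x p where w: "w = (cmap c x, p)" "x \<in> cdom c" "x \<in> cdom c'" by auto
    have z: "covec c x p \<in> leaf_dual A \<omega>" "p_coord A c (covec c x p) = p"
      using covec_in_lift[OF assms(1) w(2)] by (auto simp: cdom_lift)
    then show "(?f (fst w), \<chi> \<beta>. snd w \<bullet> snd (frechet_derivative (cmap c \<circ> cinv c') (at (?f (fst w))) (0, axis \<beta> 1)))
      = (cmap (lift c') \<circ> cinv (lift c)) w"
      using w c c' p_coord_change[OF assms z(1)]
      by (simp add: cinv_lift[OF assms(1)] cmap_lift)
  qed
qed

lemma atlas_dual: "atlas DA"
proof
  have 1: "cdom (lift c) \<inter> cdom (lift c') = {z \<in> leaf_dual A \<omega>. fst z \<in> cdom c \<inter> cdom c'}" for c c'
    by (auto simp: cdom_lift)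
  have 2: "cmap (lift c) ` cdom (lift c) = (cmap c ` cdom c) \<times> UNIV" if "c \<in> FC" for c
    using lift_image[OF that order_refl] by (simp add: cdom_lift)
  have 3: "cmap (lift c) ` (cdom (lift c) \<inter> cdom (lift c')) = (cmap c ` (cdom c \<inter> cdom c')) \<times> UNIV" if "c \<in> FC" for c c'
    unfolding 1 by (rule lift_image[OF that]) auto
  show "smooth_atlas DA"
    unfolding smooth_atlas_def dual_atlas_def ball_simps
    using inj_on_lift lift_transition_smooth
    by (auto simp: 2 3 foliation_chart open_image open_overlap open_Times simp del: fst_conv snd_conv)
qed

sublocale dual: atlas DA by (rule atlas_dual)

lemma lift_in_dual: "c \<in> FC \<Longrightarrow> lift c \<in> DA"
  by (simp add: dual_atlas_def)

lemma smooth_fst: "smooth_map DA A fst"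
  unfolding smooth_map_def
proof (intro conjI ballI)
  show "fst ` points DA \<subseteq> points A"
    by (auto simp: points_def dual_atlas_def cdom_lift leaf_dual_def)
  fix C d assume "C \<in> DA" and d: "d \<in> A"
  then obtain c where c: "c \<in> FC" "C = lift c" by (auto simp: dual_atlas_def)
  note cA = foliation_chart[OF c(1)]
  have img: "cmap C ` {z \<in> cdom C. fst z \<in> cdom d} = (cmap c ` (cdom c \<inter> cdom d)) \<times> UNIV"
    using lift_image[OF c(1), of "cdom c \<inter> cdom d"] by (simp add: c(2) cdom_lift conj_assoc)
  show op: "open (cmap C ` {z \<in> cdom C. fst z \<in> cdom d})"
    unfolding img by (intro open_Times open_overlap cA d open_UNIV)
  show "smooth_on (cmap C ` {z \<in> cdom C. fst z \<in> cdom d}) (cmap d \<circ> fst \<circ> cinv C)"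
  proof (rule smooth_on_cong[OF op])
    show "smooth_on (cmap C ` {z \<in> cdom C. fst z \<in> cdom d}) (\<lambda>w. (cmap d \<circ> cinv c) (fst w))"
      unfolding img by (rule smooth_on_compose_fst[OF open_overlap smooth_transition]) (use cA d in auto)
  qed (unfold img, use c in \<open>auto simp: cinv_lift\<close>)
qed

text \<open>In induced coordinates the bundle projection is \<open>((y, q), p) \<mapsto> (y, q)\<close>.\<close>

lemma differential_fst:
  assumes "c \<in> FC" "z \<in> cdom (lift c)" "\<xi> \<in> tangent_space DA z"
  shows "differential DA A fst z \<xi> = coord_vec A c (fst z) (fst (\<xi> (lift c)))"
proof -
  have x: "fst z \<in> cdom c" using assms(2) by (simp add: cdom_lift)
  note cA = foliation_chart[OF assms(1)]
  have "((cmap c \<circ> fst \<circ> cinv (lift c)) has_derivative fst) (at (cmap (lift c) z))"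
  proof (rule has_derivative_transform_within_open[OF bounded_linear_imp_has_derivative[OF bounded_linear_fst]
        dual.open_image[OF lift_in_dual[OF assms(1)]]])
    fix w assume "w \<in> cmap (lift c) ` cdom (lift c)"
    then have "fst w \<in> cmap c ` cdom c" by (auto simp: cmap_lift cdom_lift)
    then show "fst w = (cmap c \<circ> fst \<circ> cinv (lift c)) w"
      by (simp add: cinv_lift[OF assms(1)] cmap_cinv)
  qed (use assms in auto)
  from frechet_eq[OF this]
  have 1: "differential DA A fst z \<xi> c = fst (\<xi> (lift c))"
    using differential_coord[OF atlas_dual atlas_axioms smooth_fst assms(3) lift_in_dual[OF assms(1)] assms(2) cA x]
    by simp
  have "z \<in> points DA" unfolding points_def using assms(2) lift_in_dual[OF assms(1)] by blast
  from tangent_eq_coord_vec[OF differential_in_tangent_space[OF atlas_dual atlas_axioms smooth_fst assms(3) this] cA x]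
  show ?thesis using 1 by simp
qed

section \<open>The canonical one-form of the splitting\<close>

text \<open>In coordinates, \<open>\<theta>\<^sub>G = p\<^sub>\<beta> (dq\<^sup>\<beta> - R\<^sub>i\<^sup>\<beta> dy\<^sup>i)\<close>.\<close>

lemma theta_coord:
  assumes "c \<in> FC" "z \<in> cdom (lift c)" "\<xi> \<in> tangent_space DA z"
  shows "theta_G A \<omega> G z \<xi> = p_coord A c z \<bullet> (snd (fst (\<xi> (lift c))) - hor c (fst z) (fst (fst (\<xi> (lift c)))))"
proof -
  have z: "z \<in> leaf_dual A \<omega>" "fst z \<in> cdom c" using assms(2) by (auto simp: cdom_lift)
  show ?thesis
    by (simp add: theta_G_def differential_fst[OF assms] proj_along_coord[OF assms(1) z(2)] coord_vec_q[OF assms(1) z])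
qed

lemma theta_coord_vec:
  assumes "c \<in> FC" "w \<in> cmap (lift c) ` cdom (lift c)"
  shows "theta_G A \<omega> G (cinv (lift c) w) (coord_vec DA (lift c) (cinv (lift c) w) e) =
    snd w \<bullet> (snd (fst e) - (\<Sum>i\<in>UNIV. fst (fst e) $ i *\<^sub>R R c i (cinv c (fst w))))"
proof -
  note l = lift_in_dual[OF assms(1)] dual.cinv_in_cdom[OF assms(2)]
  have "fst w \<in> cmap c ` cdom c" using assms(2) by (auto simp: cmap_lift cdom_lift)
  then have "fst (cinv (lift c) w) = cinv c (fst w)" "p_coord A c (cinv (lift c) w) = snd w"
    using covec_in_lift[OF assms(1) cinv_in_cdom] by (simp_all add: cinv_lift[OF assms(1)])
  then show ?thesis
    using theta_coord[OF assms(1) l(2) dual.coord_vec_in_tangent_space[OF l]] l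
    by (simp add: hor_def)
qed

lemma one_form_theta: "one_form DA (theta_G A \<omega> G)"
  unfolding one_form_def
proof (intro conjI ballI allI)
  fix z assume "z \<in> points DA"
  then obtain c where c: "c \<in> FC" "z \<in> cdom (lift c)" by (auto simp: points_def dual_atlas_def)
  note l = lift_in_dual[OF c(1)] c(2)
  have add: "(\<lambda>d. \<xi> d + \<eta> d) \<in> tangent_space DA z" and sc: "(\<lambda>d. r *\<^sub>R \<xi> d) \<in> tangent_space DA z"
    if "\<xi> \<in> tangent_space DA z" "\<eta> \<in> tangent_space DA z" for \<xi> \<eta> r
  proof -
    have "(\<lambda>d. \<xi> d + \<eta> d) = coord_vec DA (lift c) z (\<xi> (lift c) + \<eta> (lift c))"
      unfolding dual.coord_vec_add[OF l]
      using dual.tangent_eq_coord_vec[OF that(1) l] dual.tangent_eq_coord_vec[OF that(2) l] by metis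
    then show "(\<lambda>d. \<xi> d + \<eta> d) \<in> tangent_space DA z" using dual.coord_vec_in_tangent_space[OF l] by simp
    have "(\<lambda>d. r *\<^sub>R \<xi> d) = coord_vec DA (lift c) z (r *\<^sub>R \<xi> (lift c))"
      unfolding dual.coord_vec_scale[OF l]
      using dual.tangent_eq_coord_vec[OF that(1) l] by metis
    then show "(\<lambda>d. r *\<^sub>R \<xi> d) \<in> tangent_space DA z" using dual.coord_vec_in_tangent_space[OF l] by simp
  qed
  show "tlinear (tangent_space DA z) (theta_G A \<omega> G z)"
    unfolding tlinear_def
    by (simp add: theta_coord[OF c] add sc linear_add[OF linear_hor] linear_scale[OF linear_hor]
        inner_diff_right inner_add_right algebra_simps)
next
  fix C e assume "C \<in> DA"
  then obtain c where c: "c \<in> FC" "C = lift c" by (auto simp: dual_atlas_def)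
  note l = lift_in_dual[OF c(1)] and op = dual.open_image[OF lift_in_dual[OF c(1)]]
  have img: "cmap (lift c) ` cdom (lift c) = (cmap c ` cdom c) \<times> UNIV"
    using lift_image[OF c(1) order_refl] by (simp add: cdom_lift)
  show "smooth_on (cmap C ` cdom C) (\<lambda>u. theta_G A \<omega> G (cinv C u) (coord_vec DA C (cinv C u) e))"
    unfolding c(2)
  proof (rule smooth_on_cong[OF op])
    let ?S = "(cmap c ` cdom c) \<times> (UNIV :: (real^'q) set)"
    have opS: "open ?S" using op by (simp add: img)
    have "smooth_on ?S (\<lambda>w. R c i (cinv c (fst w)))" for i
      by (rule smooth_on_compose_fst[OF open_image[OF foliation_chart[OF c(1)]] smooth_R[OF c(1)]])
    then have "smooth_on ?S (\<lambda>w. - fst (fst e) $ i *\<^sub>R R c i (cinv c (fst w)))" for i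
      by (rule smooth_on_linear_compose[OF opS bounded_linear_scaleR_right])
    then have "smooth_on ?S (\<lambda>w. snd w \<bullet> (snd (fst e) + (\<Sum>i\<in>UNIV. - fst (fst e) $ i *\<^sub>R R c i (cinv c (fst w)))))"
      by (intro smooth_on_bilinear[OF opS bounded_bilinear_inner] smooth_on_add smooth_on_sum smooth_on_const opS
        smooth_on_bounded_linear[OF opS bounded_linear_snd])
    then show "smooth_on (cmap (lift c) ` cdom (lift c))
       (\<lambda>w. snd w \<bullet> (snd (fst e) - (\<Sum>i\<in>UNIV. fst (fst e) $ i *\<^sub>R R c i (cinv c (fst w)))))"
      unfolding img by (simp add: sum_negf)
  qed (simp add: theta_coord_vec[OF c(1)])
qed

section \<open>The two-form of the thickening in an adapted frame\<close>

definition R_deriv :: "('a, ('y, 'q) yq) chart \<Rightarrow> 'a \<Rightarrow> 'y \<Rightarrow> ('y, 'q) yq \<Rightarrow> real^'q" where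
  "R_deriv c x i = frechet_derivative (R c i \<circ> cinv c) (at (cmap c x))"

lemma R_has_derivative:
  assumes "c \<in> FC" "x \<in> cdom c"
  shows "((R c i \<circ> cinv c) has_derivative R_deriv c x i) (at (cmap c x))"
  unfolding R_deriv_def using assms
  by (intro has_frechet smooth_on_differentiable[OF smooth_R[OF assms(1), folded o_def]]) auto

lemma linear_R_deriv:
  assumes "c \<in> FC" "x \<in> cdom c"
  shows "linear (R_deriv c x i)"
  by (rule has_derivative_linear[OF R_has_derivative[OF assms]])

lemma cderiv_R:
  assumes "c \<in> FC" "x \<in> cdom c"
  shows "cderiv c (\<lambda>x. R c i x $ \<beta>) x e = R_deriv c x i e $ \<beta>"
proof -
  have "((\<lambda>u. (R c i \<circ> cinv c) u $ \<beta>) has_derivative (\<lambda>e. R_deriv c x i e $ \<beta>)) (at (cmap c x))"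
    by (rule bounded_linear.has_derivative[OF bounded_linear_vec_nth R_has_derivative[OF assms]])
  from frechet_eq[OF this] show ?thesis by (simp add: cderiv_def o_def)
qed

text \<open>\<open>F\<^sub>i\<^sub>j\<close> is the derivative of \<open>R\<^sub>j\<close> along the \<open>i\<close>-th frame vector of \<open>G\<close> minus the same with \<open>i\<close> and \<open>j\<close>
  exchanged.\<close>

lemma F_curv_eq:
  assumes "c \<in> FC" "x \<in> cdom c"
  shows "F_curv A G c x \<beta> i j = (R_deriv c x j (axis i 1, R c i x) - R_deriv c x i (axis j 1, R c j x)) $ \<beta>"
proof -
  have "R_deriv c x j (a, r) $ \<beta> = R_deriv c x j (a, 0) $ \<beta> + (\<Sum>\<gamma>\<in>UNIV. r $ \<gamma> * R_deriv c x j (0, axis \<gamma> 1) $ \<beta>)" for j a r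
  proof -
    have "R_deriv c x j (a, r) = R_deriv c x j (a, 0) + R_deriv c x j (0, r)"
      using linear_add[OF linear_R_deriv[OF assms], of j "(a, 0)" "(0, r)"] by simp
    also have "R_deriv c x j (0, r) = (\<Sum>\<gamma>\<in>UNIV. r $ \<gamma> *\<^sub>R R_deriv c x j (0, axis \<gamma> 1))"
      using linear_yq_expansion[OF linear_R_deriv[OF assms], of j 0 r] by simp
    finally show ?thesis by simp
  qed
  from this[of j "axis i 1" "R c i x"] this[of i "axis j 1" "R c j x"] show ?thesis
    by (simp add: F_curv_def Let_def cderiv_R[OF assms])
qed

text \<open>Only \<open>p\<close> and \<open>R\<^sub>i\<close> vary in the coordinate expression of \<open>\<theta>\<^sub>G\<close>; these are the two terms.\<close>

lemma cderiv_theta: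
  assumes "c \<in> FC" "z \<in> cdom (lift c)"
  shows "cderiv (lift c) (\<lambda>y. theta_G A \<omega> G y (coord_vec DA (lift c) y e)) z d =
    snd d \<bullet> (snd (fst e) - hor c (fst z) (fst (fst e)))
    - p_coord A c z \<bullet> (\<Sum>i\<in>UNIV. fst (fst e) $ i *\<^sub>R R_deriv c (fst z) i (fst d))"
proof -
  have x: "fst z \<in> cdom c" using assms(2) by (simp add: cdom_lift)
  note l = lift_in_dual[OF assms(1)]
  have "((\<lambda>w. R c i (cinv c (fst w))) has_derivative (\<lambda>d. R_deriv c (fst z) i (fst d))) (at (cmap (lift c) z))" for i
    by (rule has_derivative_compose[OF bounded_linear_imp_has_derivative[OF bounded_linear_fst]])
      (simp add: cmap_lift R_has_derivative[OF assms(1) x, unfolded o_def])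
  then have "((\<lambda>w. snd w \<bullet> (snd (fst e) - (\<Sum>i\<in>UNIV. fst (fst e) $ i *\<^sub>R R c i (cinv c (fst w))))) has_derivative
     (\<lambda>d. snd (cmap (lift c) z) \<bullet> (0 - (\<Sum>i\<in>UNIV. fst (fst e) $ i *\<^sub>R R_deriv c (fst z) i (fst d))) +
        snd d \<bullet> (snd (fst e) - (\<Sum>i\<in>UNIV. fst (fst e) $ i *\<^sub>R R c i (cinv c (fst (cmap (lift c) z)))))))
     (at (cmap (lift c) z))"
    by (intro has_derivative_inner has_derivative_diff has_derivative_const has_derivative_sum
        has_derivative_scaleR_right bounded_linear_imp_has_derivative[OF bounded_linear_snd])
  then have "((\<lambda>w. theta_G A \<omega> G (cinv (lift c) w) (coord_vec DA (lift c) (cinv (lift c) w) e)) has_derivative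
     (\<lambda>d. snd (cmap (lift c) z) \<bullet> (0 - (\<Sum>i\<in>UNIV. fst (fst e) $ i *\<^sub>R R_deriv c (fst z) i (fst d))) +
        snd d \<bullet> (snd (fst e) - (\<Sum>i\<in>UNIV. fst (fst e) $ i *\<^sub>R R c i (cinv c (fst (cmap (lift c) z)))))))
     (at (cmap (lift c) z))"
    by (rule has_derivative_transform_within_open[OF _ dual.open_image[OF l]])
      (use assms in \<open>auto simp: theta_coord_vec\<close>)
  from frechet_eq[OF this] show ?thesis
    using x foliation_chart[OF assms(1)] by (simp add: cderiv_def o_def hor_def cmap_lift)
qed

lemma frame_sum: "(\<Sum>i\<in>UNIV. a $ i *\<^sub>R (axis i 1, R c i x)) = (a, hor c x a)"
  using basis_expansion[of a] by (simp add: prod_eq_iff fst_sum snd_sum hor_def scalar_mult_eq_scaleR)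

text \<open>Expansion in the frame of \<open>G \<oplus> E\<close>: the vector \<open>(a, t)\<close> is the sum of its part \<open>(a, hor a)\<close> in \<open>G\<close> and
  its part \<open>(0, t - hor a)\<close> in \<open>E\<close>.\<close>

lemma linear_frame_expansion:
  fixes f :: "('y, 'q) yq \<Rightarrow> 'w::real_vector"
  assumes "linear f"
  shows "f e = (\<Sum>i\<in>UNIV. fst e $ i *\<^sub>R f (axis i 1, R c i x)) + f (0, snd e - hor c x (fst e))"
proof -
  have "e = (\<Sum>i\<in>UNIV. fst e $ i *\<^sub>R (axis i 1, R c i x)) + (0, snd e - hor c x (fst e))"
    unfolding frame_sum by (cases e) simp
  from arg_cong[OF this, of f] show ?thesis
    by (simp only: linear_add[OF assms] linear_sum[OF assms] linear_scale[OF assms])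
qed

lemma linear_fibre_expansion:
  fixes f :: "('y, 'q) yq \<Rightarrow> 'w::real_vector"
  assumes "linear f"
  shows "f (0, t) = (\<Sum>\<gamma>\<in>UNIV. t $ \<gamma> *\<^sub>R f (0, axis \<gamma> 1))"
  using linear_yq_expansion[OF assms, of 0 t] by simp

lemma linear_b:
  assumes "c \<in> FC" "x \<in> cdom c"
  shows "linear (\<lambda>e. b x (coord_vec A c x e))"
proof (rule tlinear_coord)
  show "tlinear (tangent_space A x) (b x)"
    using one_form in_points[OF assms] unfolding one_form_def by blast
qed (use assms foliation_chart in auto)

text \<open>Only the \<open>y\<close>-coordinates count, because \<open>\<omega>\<close> vanishes on its kernel.\<close>

lemma \<omega>_coord:
  assumes "c \<in> FC" "x \<in> cdom c"
  shows "\<omega> x (coord_vec A c x e) (coord_vec A c x e') =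
    (\<Sum>i\<in>UNIV. \<Sum>j\<in>UNIV. fst e $ i * fst e' $ j * \<omega> x (d_y A c x i) (d_y A c x j))"
proof -
  note c = foliation_chart[OF assms(1)] assms(2)
  note T = coord_vec_in_tangent_space[OF c]
  have tl: "tlinear (tangent_space A x) (\<omega> x v)" 
    and skew: "w \<in> tangent_space A x \<Longrightarrow> \<omega> x v w = - \<omega> x w v" if "v \<in> tangent_space A x" for v w
    using two_form in_points[OF assms] that unfolding two_form_def by blast+
  have ker: "\<omega> x (coord_vec A c x (0, t)) w = 0" if "w \<in> tangent_space A x" for t w
    using coord_vec_in_E_iff[OF assms, of "(0, t)"] that unfolding ker_form_def by simp
  have lin2: "linear (\<lambda>e. \<omega> x v (coord_vec A c x e))" if "v \<in> tangent_space A x" for v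
    by (rule tlinear_coord[OF c tl[OF that]])
  have 2: "\<omega> x v (coord_vec A c x e') = (\<Sum>j\<in>UNIV. fst e' $ j * \<omega> x v (d_y A c x j))"
    if "v \<in> tangent_space A x" for v e'
  proof -
    have "\<omega> x v (coord_vec A c x (0, axis \<gamma> 1)) = 0" for \<gamma>
      using skew[OF that T] ker[OF that] by simp
    then show ?thesis
      using linear_yq_expansion[OF lin2[OF that], of "fst e'" "snd e'"] by simp
  qed
  have "\<omega> x (coord_vec A c x e) w = (\<Sum>i\<in>UNIV. fst e $ i * \<omega> x (d_y A c x i) w)"
    if "w \<in> tangent_space A x" for w
  proof -
    have flip: "\<omega> x (coord_vec A c x e) w = - \<omega> x w (coord_vec A c x e)" for e
      by (rule skew[OF T that])
    show ?thesis unfolding flip[of e] 2[OF that, of e] by (simp add: flip sum_negf)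
  qed
  from this[OF T, of e'] show ?thesis
    unfolding 2[OF T, where e'=e'] by (simp add: sum_distrib_left mult.assoc)
qed

text \<open>The coordinates of the projection to \<open>E\<close> along \<open>G\<close>, that is, the values of the coframe \<open>f\<^sub>\<beta>\<^sup>*\<close> (lemma
  \<open>f_star_eq\<close>).\<close>

abbreviation \<tau> where "\<tau> c x e \<equiv> snd e - hor c x (fst e)"

text \<open>The coefficient vector of the \<open>\<partial>/\<partial>p\<^sub>\<nu>\<close> in the frame \<open>e\<^sub>j\<close>, \<open>f\<^sub>\<alpha>\<close>, \<open>\<partial>/\<partial>p\<^sub>\<nu>\<close>. As an explicit linear
  expression it is easier to compute with than \<open>vertical_proj\<close>, with which it agrees (lemma
  \<open>vertical_proj_eq\<close>).\<close>

definition vert ::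
  "('a, ('y, 'q) yq) chart \<Rightarrow> ('a, ('y, 'q) yq) covector \<Rightarrow> ('y, 'q) yqp \<Rightarrow> real^'q" where
  "vert c z e = snd e - (\<Sum>j\<in>UNIV. fst (fst e) $ j *\<^sub>R snd (e_vec A b G c z j))
     - (\<Sum>\<alpha>\<in>UNIV. \<tau> c (fst z) (fst e) $ \<alpha> *\<^sub>R snd (f_vec A b c z \<alpha>))"

lemma linear_vert: "linear (vert c z)"
  by (intro linearI)
    (simp_all add: vert_def linear_add[OF linear_hor] linear_scale[OF linear_hor] sum.distrib
      sum_subtractf scaleR_sum_right algebra_simps)

text \<open>On the fibres of the coordinate projection, \<open>vert\<close> is a translation. Hence \<open>((a, t), \<pi>)\<close> and
  \<open>(a, \<tau>, \<rho>)\<close> determine each other, and vectors over the same \<open>(a, t)\<close> can be compared by \<open>vert\<close>.\<close>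

lemma vert_shift: "vert c z (e, r + r') = r + vert c z (e, r')"
  by (simp add: vert_def)

lemma fst_e_vec: "fst (e_vec A b G c z j) = (axis j 1, R c j (fst z))"
  and fst_f_vec: "fst (f_vec A b c z \<alpha>) = (0, axis \<alpha> 1)"
  by (simp_all add: e_vec_def f_vec_def Let_def)

lemma vert_e_vec: "vert c z (e_vec A b G c z j) = 0"
  by (simp add: vert_def fst_e_vec sum_axis_scaleR)

lemma vert_f_vec: "vert c z (f_vec A b c z \<alpha>) = 0"
  using linear_0[OF linear_hor] by (simp add: vert_def fst_f_vec sum_axis_scaleR)

lemma vert_decomposition:
  "e = (\<Sum>j\<in>UNIV. fst (fst e) $ j *\<^sub>R e_vec A b G c z j)
     + (\<Sum>\<alpha>\<in>UNIV. \<tau> c (fst z) (fst e) $ \<alpha> *\<^sub>R f_vec A b c z \<alpha>) + (0, vert c z e)"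
proof -
  have "(\<Sum>j\<in>UNIV. fst (fst e) $ j *\<^sub>R axis j (1::real)) = fst (fst e)"
    "(\<Sum>\<alpha>\<in>UNIV. \<tau> c (fst z) (fst e) $ \<alpha> *\<^sub>R axis \<alpha> (1::real)) = \<tau> c (fst z) (fst e)"
    using basis_expansion[of "fst (fst e)"] basis_expansion[of "\<tau> c (fst z) (fst e)"]
    by (simp_all only: scalar_mult_eq_scaleR)
  then show ?thesis
    by (simp only: prod_eq_iff fst_add snd_add fst_sum snd_sum fst_scaleR snd_scaleR fst_e_vec fst_f_vec
        fst_conv snd_conv) (simp add: vert_def hor_def)
qed

lemma vertical_proj_eq: "vertical_proj A \<omega> b G c z \<xi> = vert c z (\<xi> (lift c))"
  unfolding vertical_proj_def
proof (rule the_equality)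
  let ?B = "range (e_vec A b G c z) \<union> range (f_vec A b c z)"
  let ?e = "\<xi> (lift c)"
  have "?e - (0, vert c z ?e) = (\<Sum>j\<in>UNIV. fst (fst ?e) $ j *\<^sub>R e_vec A b G c z j)
     + (\<Sum>\<alpha>\<in>UNIV. \<tau> c (fst z) (fst ?e) $ \<alpha> *\<^sub>R f_vec A b c z \<alpha>)"
    unfolding diff_eq_eq by (rule vert_decomposition)
  also have "\<dots> \<in> span ?B"
    by (intro span_add span_sum span_scale span_base) auto
  finally show "?e - (0, vert c z ?e) \<in> span ?B" .
  fix r assume r: "?e - (0, r) \<in> span ?B"
  have "vert c z (?e - (0, r)) = 0"
    by (rule linear_eq_0_on_span[OF linear_vert _ r]) (auto simp: vert_e_vec vert_f_vec)
  moreover have "vert c z (0, r) = r"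
    using vert_shift[of c z 0 r 0] linear_0[OF linear_vert] by (simp add: zero_prod_def)
  ultimately show "r = vert c z ?e" by (simp add: linear_diff[OF linear_vert])
qed

lemma inner_R_deriv_fibre:
  assumes "c \<in> FC" "x \<in> cdom c"
  shows "p \<bullet> R_deriv c x j (0, t) = (\<Sum>\<nu>\<in>UNIV. t $ \<nu> * (p \<bullet> R_deriv c x j (0, axis \<nu> 1)))"
  by (subst linear_fibre_expansion[OF linear_R_deriv[OF assms]]) (simp add: inner_sum_right)

text \<open>The first summand of the \<open>p\<close>-component of \<open>e\<^sub>j\<close> contains \<open>b\<close> evaluated on the \<open>j\<close>-th frame vector of
  \<open>G\<close>. Paired with \<open>t\<close>, the second one is the derivative of \<open>R\<^sub>j\<close> in the leaf direction \<open>t\<close>.\<close>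

lemma e_vec_inner:
  assumes "c \<in> FC" "fst z \<in> cdom c"
  shows "snd (e_vec A b G c z j) \<bullet> t =
    - (b (fst z) (coord_vec A c (fst z) (axis j 1, R c j (fst z))) * (p_coord A c z \<bullet> t)
       + p_coord A c z \<bullet> R_deriv c (fst z) j (0, t))"
proof -
  let ?x = "fst z" and ?p = "p_coord A c z"
  have "b ?x (coord_vec A c ?x (axis j 1, R c j ?x)) =
      b ?x (d_y A c ?x j) + b ?x (coord_vec A c ?x (0, R c j ?x))"
    using linear_add[OF linear_b[OF assms], of "(axis j 1, 0)" "(0, R c j ?x)"] by simp
  also have "b ?x (coord_vec A c ?x (0, R c j ?x)) = (\<Sum>\<gamma>\<in>UNIV. b ?x (d_q A c ?x \<gamma>) * R c j ?x $ \<gamma>)"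
    using linear_fibre_expansion[OF linear_b[OF assms], of "R c j ?x"] by (simp add: mult.commute)
  finally have "snd (e_vec A b G c z j) = - (b ?x (coord_vec A c ?x (axis j 1, R c j ?x)) *\<^sub>R ?p
      + (\<chi> \<nu>. ?p \<bullet> R_deriv c ?x j (0, axis \<nu> 1)))"
    by (simp add: e_vec_def Let_def cderiv_R[OF assms] vec_eq_iff inner_vec_def mult.commute)
  moreover have "(\<chi> \<nu>. ?p \<bullet> R_deriv c ?x j (0, axis \<nu> 1)) \<bullet> t = ?p \<bullet> R_deriv c ?x j (0, t)"
    unfolding inner_R_deriv_fibre[OF assms, where t=t] by (subst inner_vec_def) (simp add: mult.commute)
  ultimately show ?thesis by (simp add: inner_diff_left inner_add_left)
qed

lemma f_vec_inner:
  "snd (f_vec A b c z \<alpha>) \<bullet> t = - (b (fst z) (d_q A c (fst z) \<alpha>) * (p_coord A c z \<bullet> t))"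
proof -
  have "snd (f_vec A b c z \<alpha>) = - (b (fst z) (d_q A c (fst z) \<alpha>) *\<^sub>R p_coord A c z)"
    by (simp add: f_vec_def vec_eq_iff mult.commute)
  then show ?thesis by simp
qed

text \<open>The values of \<open>b\<close> on the frame vectors add up to its value on the whole base vector. This is where
  the \<open>b\<close>-terms of \<open>e\<^sub>j\<close> and of \<open>f\<^sub>\<alpha>\<close> are both needed.\<close>

lemma vert_inner:
  assumes "c \<in> FC" "fst z \<in> cdom c"
  shows "vert c z e \<bullet> t = snd e \<bullet> t + b (fst z) (coord_vec A c (fst z) (fst e)) * (p_coord A c z \<bullet> t)
     + (\<Sum>j\<in>UNIV. fst (fst e) $ j * (p_coord A c z \<bullet> R_deriv c (fst z) j (0, t)))"
proof -
  let ?x = "fst z" and ?p = "p_coord A c z"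
  have "b ?x (coord_vec A c ?x (fst e)) =
      (\<Sum>i\<in>UNIV. fst (fst e) $ i * b ?x (coord_vec A c ?x (axis i 1, R c i ?x)))
      + (\<Sum>\<gamma>\<in>UNIV. \<tau> c ?x (fst e) $ \<gamma> * b ?x (d_q A c ?x \<gamma>))"
    using linear_frame_expansion[OF linear_b[OF assms], of "fst e" c ?x]
      linear_fibre_expansion[OF linear_b[OF assms], of "\<tau> c ?x (fst e)"] by simp
  moreover have "vert c z e \<bullet> t = snd e \<bullet> t
     - (\<Sum>j\<in>UNIV. fst (fst e) $ j * (snd (e_vec A b G c z j) \<bullet> t))
     - (\<Sum>\<alpha>\<in>UNIV. \<tau> c ?x (fst e) $ \<alpha> * (snd (f_vec A b c z \<alpha>) \<bullet> t))"
    by (simp add: vert_def inner_diff_left inner_sum_left del: vector_minus_component)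
  ultimately show ?thesis
    unfolding e_vec_inner[OF assms] f_vec_inner sum_mult_neg_affine sum_mult_neg
    by (simp add: distrib_right)
qed

text \<open>The normal form of the two-form. In \<open>d\<theta>\<^sub>G\<close> the derivatives of \<open>R\<close> along \<open>G\<close> give the curvature term of
  \<open>omega_tilde\<close>, while the derivatives along the leaves, together with \<open>\<pi>\<^sup>*b \<and> \<theta>\<^sub>G\<close>, are exactly what
  distinguishes \<open>\<rho>\<close> from the \<open>p\<close>-component.\<close>

lemma omega_U_coord:
  assumes c: "c \<in> FC" and z: "s x \<in> cdom (lift c)" "fst (s x) = x"
    and T: "\<xi> \<in> tangent_space DA (s x)" "\<eta> \<in> tangent_space DA (s x)"
  shows "omega_U A \<omega> b G (s x) \<xi> \<eta> =
     fst (fst (\<xi> (lift c))) \<bullet> (omega_tilde A \<omega> G s c x *v fst (fst (\<eta> (lift c))))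
     - vert c (s x) (\<xi> (lift c)) \<bullet> \<tau> c x (fst (\<eta> (lift c)))
     + vert c (s x) (\<eta> (lift c)) \<bullet> \<tau> c x (fst (\<xi> (lift c)))"
proof -
  have x: "x \<in> cdom c" using z by (simp add: cdom_lift)
  have x': "fst (s x) \<in> cdom c" using x z by simp
  note l = lift_in_dual[OF c]
  define p e e' where "p = p_coord A c (s x)" and "e = \<xi> (lift c)" and "e' = \<eta> (lift c)"
  define a a' where "a = fst (fst e)" and "a' = fst (fst e')"
  \<comment> \<open>\<open>X - Y\<close> is the curvature part of \<open>omega_tilde\<close>, evaluated on \<open>a\<close> and \<open>a'\<close>.\<close>
  define X where "X = (\<Sum>i\<in>UNIV. \<Sum>j\<in>UNIV. a $ i * a' $ j * (p \<bullet> R_deriv c x j (axis i 1, R c i x)))"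
  define Y where "Y = (\<Sum>i\<in>UNIV. \<Sum>j\<in>UNIV. a $ i * a' $ j * (p \<bullet> R_deriv c x i (axis j 1, R c j x)))"
  define \<Omega> where "\<Omega> = (\<Sum>i\<in>UNIV. \<Sum>j\<in>UNIV. a $ i * a' $ j * \<omega> x (d_y A c x i) (d_y A c x j))"
  have R_deriv: "p \<bullet> R_deriv c x j d = (\<Sum>i\<in>UNIV. fst d $ i * (p \<bullet> R_deriv c x j (axis i 1, R c i x))) + p \<bullet> R_deriv c x j (0, \<tau> c x d)"
    for j d
    by (subst linear_frame_expansion[OF linear_R_deriv[OF c x], where c=c and x=x])
      (simp add: inner_add_right inner_sum_right)
  have X: "p \<bullet> (\<Sum>j\<in>UNIV. a' $ j *\<^sub>R R_deriv c x j (fst e)) = X + (\<Sum>j\<in>UNIV. a' $ j * (p \<bullet> R_deriv c x j (0, \<tau> c x (fst e))))"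
  proof -
    have "p \<bullet> (\<Sum>j\<in>UNIV. a' $ j *\<^sub>R R_deriv c x j (fst e)) =
      (\<Sum>j\<in>UNIV. \<Sum>i\<in>UNIV. a $ i * a' $ j * (p \<bullet> R_deriv c x j (axis i 1, R c i x)))
      + (\<Sum>j\<in>UNIV. a' $ j * (p \<bullet> R_deriv c x j (0, \<tau> c x (fst e))))"
      unfolding inner_sum_right inner_scaleR_right R_deriv[of _ "fst e"]
      by (simp add: distrib_left sum.distrib sum_distrib_left a_def mult_ac)
    then show ?thesis unfolding X_def by (subst (asm) sum.swap)
  qed
  have Y: "p \<bullet> (\<Sum>j\<in>UNIV. a $ j *\<^sub>R R_deriv c x j (fst e')) = Y + (\<Sum>j\<in>UNIV. a $ j * (p \<bullet> R_deriv c x j (0, \<tau> c x (fst e'))))"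
    unfolding inner_sum_right inner_scaleR_right R_deriv[of _ "fst e'"] Y_def
    by (simp add: distrib_left sum.distrib sum_distrib_left a'_def mult_ac)
  have W: "a \<bullet> (omega_tilde A \<omega> G s c x *v a') = \<Omega> + X - Y"
  proof -
    have "omega_tilde A \<omega> G s c x $ i $ j = \<omega> x (d_y A c x i) (d_y A c x j)
       + (p \<bullet> R_deriv c x j (axis i 1, R c i x) - p \<bullet> R_deriv c x i (axis j 1, R c j x))" for i j
      unfolding inner_diff_right[symmetric]
      by (simp add: omega_tilde_def F_curv_eq[OF c x] p_def inner_vec_def)
    then show ?thesis
      unfolding X_def Y_def \<Omega>_def inner_matrix_vector_mult
      by (simp add: distrib_left right_diff_distrib sum.distrib sum_subtractf)
  qed
  have \<omega>: "\<omega> x (coord_vec A c x (fst e)) (coord_vec A c x (fst e')) = \<Omega>"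
    unfolding \<omega>_coord[OF c x, of "fst e" "fst e'"] \<Omega>_def a_def a'_def ..
  have d: "ext_deriv1 DA (theta_G A \<omega> G) (s x) \<xi> \<eta> =
     (snd e \<bullet> \<tau> c x (fst e') - p \<bullet> (\<Sum>i\<in>UNIV. a' $ i *\<^sub>R R_deriv c x i (fst e)))
     - (snd e' \<bullet> \<tau> c x (fst e) - p \<bullet> (\<Sum>i\<in>UNIV. a $ i *\<^sub>R R_deriv c x i (fst e')))"
    unfolding dual.ext_deriv1_chart[OF one_form_theta l z(1) T] cderiv_theta[OF c z(1)] z(2)
      e_def e'_def a_def a'_def p_def ..
  note vx = vert_inner[OF c x', unfolded z(2), folded p_def]
  have th: "theta_G A \<omega> G (s x) \<xi> = p \<bullet> \<tau> c x (fst e)" "theta_G A \<omega> G (s x) \<eta> = p \<bullet> \<tau> c x (fst e')"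
    using theta_coord[OF c z(1) T(1)] theta_coord[OF c z(1) T(2)] z(2) by (simp_all add: e_def e'_def p_def)
  have df: "differential DA A fst (s x) \<xi> = coord_vec A c x (fst e)"
    "differential DA A fst (s x) \<eta> = coord_vec A c x (fst e')"
    using differential_fst[OF c z(1) T(1)] differential_fst[OF c z(1) T(2)] z(2) by (simp_all add: e_def e'_def)
  have "omega_U A \<omega> b G (s x) \<xi> \<eta> = \<Omega>
     - ((snd e \<bullet> \<tau> c x (fst e') - (X + (\<Sum>j\<in>UNIV. a' $ j * (p \<bullet> R_deriv c x j (0, \<tau> c x (fst e))))))
       - (snd e' \<bullet> \<tau> c x (fst e) - (Y + (\<Sum>j\<in>UNIV. a $ j * (p \<bullet> R_deriv c x j (0, \<tau> c x (fst e')))))))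
     - (b x (coord_vec A c x (fst e)) * (p \<bullet> \<tau> c x (fst e')) - b x (coord_vec A c x (fst e')) * (p \<bullet> \<tau> c x (fst e)))"
    unfolding omega_U_def Let_def wedge11_def df th z(2) d X Y \<omega> ..
  moreover have "vert c (s x) e \<bullet> \<tau> c x (fst e') = snd e \<bullet> \<tau> c x (fst e')
      + b x (coord_vec A c x (fst e)) * (p \<bullet> \<tau> c x (fst e'))
      + (\<Sum>j\<in>UNIV. a $ j * (p \<bullet> R_deriv c x j (0, \<tau> c x (fst e'))))"
    unfolding a_def by (rule vx)
  moreover have "vert c (s x) e' \<bullet> \<tau> c x (fst e) = snd e' \<bullet> \<tau> c x (fst e)
      + b x (coord_vec A c x (fst e')) * (p \<bullet> \<tau> c x (fst e))
      + (\<Sum>j\<in>UNIV. a' $ j * (p \<bullet> R_deriv c x j (0, \<tau> c x (fst e))))"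
    unfolding a'_def by (rule vx)
  ultimately have "omega_U A \<omega> b G (s x) \<xi> \<eta> = a \<bullet> (omega_tilde A \<omega> G s c x *v a')
     - vert c (s x) e \<bullet> \<tau> c x (fst e') + vert c (s x) e' \<bullet> \<tau> c x (fst e)"
    using W by linarith
  then show ?thesis unfolding a_def a'_def e_def e'_def .
qed

end

section \<open>Coisotropic sections\<close>

locale thickening_section = foliated_splitting A \<omega> b G
  for A :: "('a, ('y::finite, 'q::finite) yq) chart set" and \<omega> b G +
  fixes U :: "('a, ('y, 'q) yq) covector set"
    and s :: "'a \<Rightarrow> ('a, ('y, 'q) yq) covector"
  assumes thickening: "lcs_thickening A \<omega> b G U"
    and is_section: "smooth_section A \<omega> U s"
begin

lemma fst_s: "x \<in> points A \<Longrightarrow> fst (s x) = x"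
  and s_in_U: "x \<in> points A \<Longrightarrow> s x \<in> U"
  and smooth_s: "smooth_map A DA s"
  using is_section by (auto simp: smooth_section_def)

lemma s_in_lift:
  assumes "c \<in> FC" "x \<in> cdom c"
  shows "s x \<in> cdom (lift c)"
proof -
  have "s x \<in> points DA" using smooth_s in_points[OF assms] unfolding smooth_map_def by blast
  then have "s x \<in> leaf_dual A \<omega>" by (auto simp: points_def dual_atlas_def cdom_lift)
  then show ?thesis using fst_s[OF in_points[OF assms]] assms by (simp add: cdom_lift)
qed

definition section_deriv :: "('a, ('y, 'q) yq) chart \<Rightarrow> 'a \<Rightarrow> ('y, 'q) yq \<Rightarrow> real^'q" where
  "section_deriv c x e = snd (frechet_derivative (cmap (lift c) \<circ> s \<circ> cinv c) (at (cmap c x)) e)"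

text \<open>A section covers the identity, so only the fibre component of its derivative carries information.\<close>

lemma section_has_derivative:
  assumes "c \<in> FC" "x \<in> cdom c"
  shows "((cmap (lift c) \<circ> s \<circ> cinv c) has_derivative (\<lambda>e. (e, section_deriv c x e))) (at (cmap c x))"
proof -
  let ?F = "cmap (lift c) \<circ> s \<circ> cinv c"
  note c = foliation_chart[OF assms(1)]
  have "smooth_on (cmap c ` {y \<in> cdom c. s y \<in> cdom (lift c)}) ?F"
    using smooth_s c lift_in_dual[OF assms(1)] unfolding smooth_map_def by blast
  from smooth_on_differentiable[OF this] have D: "(?F has_derivative frechet_derivative ?F (at (cmap c x))) (at (cmap c x))"
    using s_in_lift[OF assms] assms(2) by (intro has_frechet) auto
  have "((\<lambda>u. fst (?F u)) has_derivative (\<lambda>e. e)) (at (cmap c x))"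
    by (rule has_derivative_transform_within_open[OF has_derivative_ident open_image[OF c]])
      (use assms c fst_s[OF in_points[OF assms(1)]] in \<open>auto simp: cmap_lift\<close>)
  from has_derivative_unique[OF this has_derivative_fst[OF D]]
  have "fst (frechet_derivative ?F (at (cmap c x)) e) = e" for e by metis
  then have "frechet_derivative ?F (at (cmap c x)) = (\<lambda>e. (e, section_deriv c x e))"
    by (auto simp: section_deriv_def prod_eq_iff)
  then show ?thesis using D by simp
qed

lemma linear_section_deriv:
  assumes "c \<in> FC" "x \<in> cdom c"
  shows "linear (\<lambda>e. (e, section_deriv c x e))"
  by (rule has_derivative_linear[OF section_has_derivative[OF assms]])

lemma differential_s:
  assumes "c \<in> FC" "x \<in> cdom c" "v \<in> tangent_space A x"
  shows "differential A DA s x v (lift c) = (v c, section_deriv c x (v c))"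
  using differential_coord[OF atlas_axioms atlas_dual smooth_s assms(3) foliation_chart[OF assms(1)] assms(2)
      lift_in_dual[OF assms(1)] s_in_lift[OF assms(1,2)]] frechet_eq[OF section_has_derivative[OF assms(1,2)]]
  by simp

lemma nabla_coord:
  assumes "c \<in> FC" "x \<in> cdom c"
  shows "nabla A \<omega> b G s c x (coord_vec A c x e) = vert c (s x) (e, section_deriv c x e)"
proof -
  note c = foliation_chart[OF assms(1)] assms(2)
  show ?thesis
    using differential_s[OF assms coord_vec_in_tangent_space[OF c]] coord_vec_self[OF c]
    by (simp add: nabla_def vertical_proj_eq)
qed

definition nabla_y_mat :: "('a, ('y, 'q) yq) chart \<Rightarrow> 'a \<Rightarrow> real^'q^'y" where
  "nabla_y_mat c x = (\<chi> i \<alpha>. nabla_y A \<omega> b G s c x i \<alpha>)"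

definition nabla_q_mat :: "('a, ('y, 'q) yq) chart \<Rightarrow> 'a \<Rightarrow> real^'q^'q" where
  "nabla_q_mat c x = (\<chi> \<beta> \<alpha>. nabla_q A \<omega> b G s c x \<beta> \<alpha>)"

text \<open>\<open>\<nabla>s\<close> is linear, hence determined by its components in the frame of \<open>G \<oplus> E\<close>.\<close>

lemma vert_section:
  assumes "c \<in> FC" "x \<in> cdom c"
  shows "vert c (s x) (e, section_deriv c x e) = fst e v* nabla_y_mat c x + \<tau> c x e v* nabla_q_mat c x"
proof -
  have lin: "linear (\<lambda>e. vert c (s x) (e, section_deriv c x e))"
    using linear_compose[OF linear_section_deriv[OF assms] linear_vert] by (simp add: o_def)
  show ?thesis
    by (subst linear_frame_expansion[OF lin, of e c x], subst linear_fibre_expansion[OF lin])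
      (simp add: vec_eq_iff vector_matrix_mult_def nabla_y_mat_def nabla_q_mat_def nabla_y_def nabla_q_def nabla_coord[OF assms] mult.commute
        del: vector_minus_component)
qed

text \<open>After the choice of \<open>a\<close> and \<open>\<tau>\<close>, the \<open>p\<close>-component is adjusted by \<open>vert_shift\<close>.\<close>

lemma dual_point:
  assumes "c \<in> FC" "x \<in> cdom c"
  obtains \<xi> where "\<xi> \<in> tangent_space DA (s x)" "fst (fst (\<xi> (lift c))) = a"
    "\<tau> c x (fst (\<xi> (lift c))) = t" "vert c (s x) (\<xi> (lift c)) = r"
proof -
  let ?e = "((a, t + hor c x a), r - vert c (s x) ((a, t + hor c x a), 0))"
  note l = lift_in_dual[OF assms(1)] s_in_lift[OF assms]
  have "vert c (s x) ?e = r"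
    using vert_shift[of c "s x" "fst ?e" "snd ?e" 0] by simp
  then show ?thesis
    using that[of "coord_vec DA (lift c) (s x) ?e"] dual.coord_vec_in_tangent_space[OF l] dual.coord_vec_self[OF l]
    by simp
qed

lemma \<omega>_skew:
  assumes "c \<in> FC" "x \<in> cdom c"
  shows "\<omega> x (d_y A c x i) (d_y A c x j) = - \<omega> x (d_y A c x j) (d_y A c x i)"
  using two_form in_points[OF assms] coord_vec_in_tangent_space[OF foliation_chart[OF assms(1)] assms(2)]
  unfolding two_form_def by blast

lemma omega_tilde_skew:
  assumes "c \<in> FC" "x \<in> cdom c"
  shows "transpose (omega_tilde A \<omega> G s c x) = - omega_tilde A \<omega> G s c x"
proof -
  have F: "F_curv A G c x \<beta> j i = - F_curv A G c x \<beta> i j" for \<beta> i j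
    by (simp add: F_curv_eq[OF assms])
  have W: "omega_tilde A \<omega> G s c x $ j $ i = - omega_tilde A \<omega> G s c x $ i $ j" for i j
    by (simp only: omega_tilde_def vec_lambda_beta \<omega>_skew[OF assms, where i=j and j=i] F[where i=i and j=j]) (simp add: sum_negf)
  show ?thesis
    unfolding vec_eq_iff
  proof (intro allI)
    fix i j
    show "transpose (omega_tilde A \<omega> G s c x) $ i $ j = (- omega_tilde A \<omega> G s c x) $ i $ j"
      unfolding transpose_def vec_lambda_beta vector_uminus_component by (rule W)
  qed
qed

lemma omega_U_section:
  assumes "c \<in> FC" "x \<in> cdom c" "\<xi> \<in> tangent_space DA (s x)" "\<eta> \<in> tangent_space DA (s x)"
  shows "omega_U A \<omega> b G (s x) \<xi> \<eta> =
     fst (fst (\<xi> (lift c))) \<bullet> (omega_tilde A \<omega> G s c x *v fst (fst (\<eta> (lift c))))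
     - vert c (s x) (\<xi> (lift c)) \<bullet> \<tau> c x (fst (\<eta> (lift c)))
     + vert c (s x) (\<eta> (lift c)) \<bullet> \<tau> c x (fst (\<xi> (lift c)))"
  by (rule omega_U_coord[where s=s and x=x, OF assms(1) s_in_lift[OF assms(1,2)] fst_s[OF in_points[OF assms(1,2)]] assms(3,4)])

text \<open>If \<open>W\<^sup>T a = 0\<close>, then the vector with \<open>\<tau> = 0\<close>, \<open>\<rho> = 0\<close> and this \<open>a\<close> is \<open>\<omega>\<^sub>U\<close>-orthogonal to everything.\<close>

lemma omega_tilde_invertible:
  assumes "c \<in> FC" "x \<in> cdom c"
  shows "invertible (omega_tilde A \<omega> G s c x)"
proof -
  let ?W = "omega_tilde A \<omega> G s c x"
  have "a = 0" if "transpose ?W *v a = 0" for a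
  proof -
    obtain \<xi> where \<xi>: "\<xi> \<in> tangent_space DA (s x)" "fst (fst (\<xi> (lift c))) = a"
      "\<tau> c x (fst (\<xi> (lift c))) = 0" "vert c (s x) (\<xi> (lift c)) = 0"
      using dual_point[OF assms] by metis
    have "omega_U A \<omega> b G (s x) \<xi> \<eta> = 0" if "\<eta> \<in> tangent_space DA (s x)" for \<eta>
      using \<open>transpose ?W *v a = 0\<close>
      unfolding omega_U_section[OF assms \<xi>(1) that] \<xi>(3,4) unfolding \<xi>(2)
      by (simp flip: dot_lmul_matrix)
    then have "\<xi> = (\<lambda>c. 0)"
      using thickening s_in_U[OF in_points[OF assms]] \<xi>(1) unfolding lcs_thickening_def by blast
    then show ?thesis using \<xi>(2) by simp
  qed
  then have "invertible (transpose ?W)"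
    using matrix_left_invertible_ker[of "transpose ?W"] invertible_left_inverse by blast
  then show ?thesis by (metis transpose_invertible transpose_transpose)
qed

text \<open>Translates the orthogonality relation at \<open>s x\<close> into the linear algebra of the coefficients
  \<open>(a, \<tau>, \<rho>)\<close>. The left-hand side is intrinsic, so the matrix identity holds in one foliation chart
  around \<open>x\<close> if and only if it holds in all of them.\<close>

lemma coisotropic_at_iff:
  assumes "c \<in> FC" "x \<in> cdom c"
  shows "(let L = differential A DA s x ` tangent_space A x
        in {\<xi> \<in> tangent_space DA (s x). \<forall>\<eta>\<in>L. omega_U A \<omega> b G (s x) \<xi> \<eta> = 0} \<subseteq> L) \<longleftrightarrow>
     transpose (nabla_y_mat c x) ** matrix_inv (omega_tilde A \<omega> G s c x) ** nabla_y_mat c x = nabla_q_mat c x - transpose (nabla_q_mat c x)"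
proof -
  let ?T = "tangent_space DA (s x)" and ?N = "nabla_y_mat c x" and ?M = "nabla_q_mat c x" and ?W = "omega_tilde A \<omega> G s c x"
  let ?a = "\<lambda>\<xi>. fst (fst (\<xi> (lift c)))" and ?t = "\<lambda>\<xi>. \<tau> c x (fst (\<xi> (lift c)))"
    and ?r = "\<lambda>\<xi>. vert c (s x) (\<xi> (lift c))"
  define L where "L = differential A DA s x ` tangent_space A x"
  note c = foliation_chart[OF assms(1)] assms(2) and l = lift_in_dual[OF assms(1)] s_in_lift[OF assms]
  have T: "differential A DA s x v \<in> ?T" if "v \<in> tangent_space A x" for v
    by (rule differential_in_tangent_space[OF atlas_axioms atlas_dual smooth_s that in_points[OF assms]])
  have L: "\<xi> \<in> L \<longleftrightarrow> ?r \<xi> = ?a \<xi> v* ?N + ?t \<xi> v* ?M" if "\<xi> \<in> ?T" for \<xi>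
  proof
    assume "\<xi> \<in> L"
    then obtain v where "v \<in> tangent_space A x" "\<xi> = differential A DA s x v" by (auto simp: L_def)
    then show "?r \<xi> = ?a \<xi> v* ?N + ?t \<xi> v* ?M"
      using differential_s[OF assms] vert_section[OF assms] by simp
  next
    \<comment> \<open>The only possible preimage is the projection of \<open>\<xi>\<close> to the base.\<close>
    let ?e = "fst (\<xi> (lift c))"
    assume "?r \<xi> = ?a \<xi> v* ?N + ?t \<xi> v* ?M"
    then have "vert c (s x) (?e, snd (\<xi> (lift c))) = vert c (s x) (?e, section_deriv c x ?e)"
      using vert_section[OF assms] by simp
    then have "snd (\<xi> (lift c)) = section_deriv c x ?e"
      using vert_shift[of c "s x" ?e _ 0] by (metis add.right_neutral add_right_cancel)
    then have "\<xi> (lift c) = differential A DA s x (coord_vec A c x ?e) (lift c)"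
      using differential_s[OF assms coord_vec_in_tangent_space[OF c]] coord_vec_self[OF c] by (simp add: prod_eq_iff)
    then have "\<xi> = differential A DA s x (coord_vec A c x ?e)"
      using dual.tangent_eq_coord_vec[OF that l] dual.tangent_eq_coord_vec[OF T[OF coord_vec_in_tangent_space[OF c]] l]
      by metis
    then show "\<xi> \<in> L" unfolding L_def using coord_vec_in_tangent_space[OF c] by blast
  qed
  have orth: "(\<forall>\<eta>\<in>L. omega_U A \<omega> b G (s x) \<xi> \<eta> = 0) \<longleftrightarrow>
     (\<forall>a' t'. ?a \<xi> \<bullet> (?W *v a') - ?r \<xi> \<bullet> t' + (a' v* ?N + t' v* ?M) \<bullet> ?t \<xi> = 0)" if \<xi>: "\<xi> \<in> ?T" for \<xi>
  proof safe
    fix a' t' assume *: "\<forall>\<eta>\<in>L. omega_U A \<omega> b G (s x) \<xi> \<eta> = 0"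
    obtain \<eta> where \<eta>: "\<eta> \<in> ?T" "?a \<eta> = a'" "?t \<eta> = t'" "?r \<eta> = a' v* ?N + t' v* ?M"
      using dual_point[OF assms] by metis
    then have "omega_U A \<omega> b G (s x) \<xi> \<eta> = 0" using * L[OF \<eta>(1)] by simp
    then show "?a \<xi> \<bullet> (?W *v a') - ?r \<xi> \<bullet> t' + (a' v* ?N + t' v* ?M) \<bullet> ?t \<xi> = 0"
      unfolding omega_U_section[OF assms \<xi> \<eta>(1)] \<eta>(3,4) unfolding \<eta>(2) .
  next
    fix \<eta> assume *: "\<forall>a' t'. ?a \<xi> \<bullet> (?W *v a') - ?r \<xi> \<bullet> t' + (a' v* ?N + t' v* ?M) \<bullet> ?t \<xi> = 0" and "\<eta> \<in> L"
    moreover then have \<eta>: "\<eta> \<in> ?T" using T by (auto simp: L_def)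
    ultimately show "omega_U A \<omega> b G (s x) \<xi> \<eta> = 0"
      using L[OF \<eta>] omega_U_section[OF assms \<xi> \<eta>] by metis
  qed
  have "{\<xi> \<in> ?T. \<forall>\<eta>\<in>L. omega_U A \<omega> b G (s x) \<xi> \<eta> = 0} \<subseteq> L \<longleftrightarrow>
     (\<forall>\<xi>\<in>?T. (\<forall>a' t'. ?a \<xi> \<bullet> (?W *v a') - ?r \<xi> \<bullet> t' + (a' v* ?N + t' v* ?M) \<bullet> ?t \<xi> = 0)
        \<longrightarrow> ?r \<xi> = ?a \<xi> v* ?N + ?t \<xi> v* ?M)"
    using L orth by blast
  also have "\<dots> \<longleftrightarrow> (\<forall>a t r. (\<forall>a' t'. a \<bullet> (?W *v a') - r \<bullet> t' + (a' v* ?N + t' v* ?M) \<bullet> t = 0)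
        \<longrightarrow> r = a v* ?N + t v* ?M)" (is "?P \<longleftrightarrow> ?Q")
  proof
    assume ?P
    show ?Q
    proof (intro allI impI)
      fix a t r assume *: "\<forall>a' t'. a \<bullet> (?W *v a') - r \<bullet> t' + (a' v* ?N + t' v* ?M) \<bullet> t = 0"
      obtain \<xi> where \<xi>: "\<xi> \<in> ?T" "?a \<xi> = a" "?t \<xi> = t" "?r \<xi> = r"
        using dual_point[OF assms] by metis
      from \<open>?P\<close>[rule_format, OF \<xi>(1), unfolded \<xi>(3,4), unfolded \<xi>(2)] * show "r = a v* ?N + t v* ?M" by blast
    qed
  qed blast
  also have "\<dots> \<longleftrightarrow> transpose ?N ** matrix_inv ?W ** ?N = ?M - transpose ?M"
    by (rule coisotropic_graph_linear[OF omega_tilde_skew[OF assms] omega_tilde_invertible[OF assms]])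
  finally show ?thesis unfolding L_def Let_def .
qed

definition nabla_pairing :: "('a, ('y, 'q) yq) chart \<Rightarrow> 'a \<Rightarrow> 'q \<Rightarrow> 'q \<Rightarrow> real" where
  "nabla_pairing c x \<alpha> \<beta> = (\<Sum>i\<in>UNIV. \<Sum>j\<in>UNIV. nabla_y A \<omega> b G s c x i \<alpha> * omega_tilde_inv A \<omega> G s c x $ i $ j
     * nabla_y A \<omega> b G s c x j \<beta>)"

lemma nabla_pairing_skew:
  assumes "c \<in> FC" "x \<in> cdom c"
  shows "nabla_pairing c x \<alpha> \<beta> = - nabla_pairing c x \<beta> \<alpha>"
proof -
  have "transpose (omega_tilde_inv A \<omega> G s c x) = - omega_tilde_inv A \<omega> G s c x"
    using skew_inverse[OF omega_tilde_skew[OF assms] omega_tilde_invertible[OF assms]]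
    unfolding omega_tilde_inv_def transpose_transpose by simp
  then have "transpose (omega_tilde_inv A \<omega> G s c x) $ i $ j = (- omega_tilde_inv A \<omega> G s c x) $ i $ j" for i j
    by (rule arg_cong[of _ _ "\<lambda>B. B $ i $ j"])
  then have sk: "omega_tilde_inv A \<omega> G s c x $ j $ i = - omega_tilde_inv A \<omega> G s c x $ i $ j" for i j
    unfolding transpose_def vec_lambda_beta vector_uminus_component .
  have "nabla_pairing c x \<beta> \<alpha> = (\<Sum>j\<in>UNIV. \<Sum>i\<in>UNIV. nabla_y A \<omega> b G s c x i \<beta> * omega_tilde_inv A \<omega> G s c x $ i $ j
     * nabla_y A \<omega> b G s c x j \<alpha>)" unfolding nabla_pairing_def by (rule sum.swap)
  also have "\<dots> = - nabla_pairing c x \<alpha> \<beta>"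
    unfolding nabla_pairing_def sum_negf[symmetric]
    by (intro sum.cong refl) (subst sk, simp)
  finally show ?thesis by simp
qed

lemma coisotropic_at_iff_pairing:
  assumes "c \<in> FC" "x \<in> cdom c"
  shows "(let L = differential A DA s x ` tangent_space A x
        in {\<xi> \<in> tangent_space DA (s x). \<forall>\<eta>\<in>L. omega_U A \<omega> b G (s x) \<xi> \<eta> = 0} \<subseteq> L) \<longleftrightarrow>
     (\<forall>\<alpha> \<beta>. nabla_pairing c x \<alpha> \<beta> = nabla_q A \<omega> b G s c x \<beta> \<alpha> - nabla_q A \<omega> b G s c x \<alpha> \<beta>)"
  unfolding coisotropic_at_iff[OF assms] vec_eq_iff matrix_triple_component
  by (auto simp: nabla_y_mat_def nabla_q_mat_def transpose_def[of "\<chi> \<beta> \<alpha>. nabla_q A \<omega> b G s c x \<beta> \<alpha>"] nabla_pairing_def omega_tilde_inv_def)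

lemma f_star_eq: "f_star A G c x \<alpha> v = \<tau> c x (v c) $ \<alpha>"
  by (simp add: f_star_def hor_def mult.commute)

text \<open>The functionals \<open>f\<^sub>\<alpha>\<^sup>*\<close> give the coefficients \<open>\<tau>\<close>, and these range over all of \<open>\<real>\<^sup>q\<close>.\<close>

lemma wedge_equation_iff:
  assumes "c \<in> FC" "x \<in> cdom c"
  shows "(\<forall>v\<in>tangent_space A x. \<forall>w\<in>tangent_space A x.
      (\<Sum>\<alpha>\<in>UNIV. \<Sum>\<beta>\<in>UNIV. 1/2 * nabla_pairing c x \<alpha> \<beta> * wedge11 (f_star A G c x \<alpha>) (f_star A G c x \<beta>) v w)
      = (\<Sum>\<alpha>\<in>UNIV. \<Sum>\<beta>\<in>UNIV. nabla_q A \<omega> b G s c x \<beta> \<alpha> * wedge11 (f_star A G c x \<alpha>) (f_star A G c x \<beta>) v w)) \<longleftrightarrow>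
     (\<forall>\<alpha> \<beta>. nabla_pairing c x \<alpha> \<beta> = nabla_q A \<omega> b G s c x \<beta> \<alpha> - nabla_q A \<omega> b G s c x \<alpha> \<beta>)"
proof -
  note c = foliation_chart[OF assms(1)] assms(2)
  \<comment> \<open>Already the vectors tangent to the leaves attain all values of \<open>\<tau>\<close>.\<close>
  have range: "(\<forall>v\<in>tangent_space A x. \<forall>w\<in>tangent_space A x. P (\<tau> c x (v c)) (\<tau> c x (w c))) \<longleftrightarrow> (\<forall>t t'. P t t')" for P
  proof safe
    fix t t' assume *: "\<forall>v\<in>tangent_space A x. \<forall>w\<in>tangent_space A x. P (\<tau> c x (v c)) (\<tau> c x (w c))"
    show "P t t'"
      using *[rule_format, OF coord_vec_in_tangent_space[OF c, of "(0, t)"] coord_vec_in_tangent_space[OF c, of "(0, t')"]]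
      by (simp add: coord_vec_self[OF c] linear_0[OF linear_hor])
  qed simp
  show ?thesis
    unfolding wedge11_def f_star_eq
    by (subst range[where P = "\<lambda>t t'. (\<Sum>\<alpha>\<in>UNIV. \<Sum>\<beta>\<in>UNIV. 1/2 * nabla_pairing c x \<alpha> \<beta> * (t $ \<alpha> * t' $ \<beta> - t' $ \<alpha> * t $ \<beta>)) =
        (\<Sum>\<alpha>\<in>UNIV. \<Sum>\<beta>\<in>UNIV. nabla_q A \<omega> b G s c x \<beta> \<alpha> * (t $ \<alpha> * t' $ \<beta> - t' $ \<alpha> * t $ \<beta>))"])
      (rule wedge_sum_eq_iff[OF nabla_pairing_skew[OF assms]])
qed

lemma coisotropic_graph_iff:
  assumes "null_foliation A \<omega>"
  shows "coisotropic_graph A \<omega> b G s \<longleftrightarrow> (\<forall>c\<in>FC. \<forall>x\<in>cdom c.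
     \<forall>\<alpha> \<beta>. nabla_pairing c x \<alpha> \<beta> = nabla_q A \<omega> b G s c x \<beta> \<alpha> - nabla_q A \<omega> b G s c x \<alpha> \<beta>)"
proof -
  have "points A = (\<Union>c\<in>FC. cdom c)" using assms by (simp add: null_foliation_def)
  then show ?thesis
    unfolding coisotropic_graph_def using coisotropic_at_iff_pairing by auto
qed

end

theorem theorem8p1:
  fixes A :: "('a, ('y::finite, 'q::{finite,linorder}) yq) chart set"
    and \<omega> :: "('a, ('y, 'q) yq) two_field"
    and b :: "('a, ('y, 'q) yq) one_field"
    and G :: "('a, ('y, 'q) yq) distribution"
    and U :: "('a, ('y, 'q) yq) covector set"
    and s :: "'a \<Rightarrow> ('a, ('y, 'q) yq) covector"
    and n k :: nat
  assumes "CARD('y) = 2 * k" and "CARD('q) + k = n"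
    and "lcps_manifold k A \<omega> b"
    and "null_foliation A \<omega>"
    and "splitting A \<omega> G"
    and "lcs_thickening A \<omega> b G U"
    and "smooth_section A \<omega> U s"
  shows
    "(coisotropic_graph A \<omega> b G s \<longleftrightarrow>
       (\<forall>c\<in>foliation_charts A \<omega>. \<forall>x\<in>cdom c. \<forall>\<alpha> \<beta>. \<alpha> > \<beta> \<longrightarrow>
          (\<Sum>i\<in>UNIV. \<Sum>j\<in>UNIV.
             nabla_y A \<omega> b G s c x i \<alpha> * omega_tilde_inv A \<omega> G s c x $ i $ j
               * nabla_y A \<omega> b G s c x j \<beta>)
          = nabla_q A \<omega> b G s c x \<beta> \<alpha> - nabla_q A \<omega> b G s c x \<alpha> \<beta>)) \<and>
     (coisotropic_graph A \<omega> b G s \<longleftrightarrow>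
       (\<forall>c\<in>foliation_charts A \<omega>. \<forall>x\<in>cdom c.
          \<forall>v\<in>tangent_space A x. \<forall>w\<in>tangent_space A x.
          (\<Sum>\<alpha>\<in>UNIV. \<Sum>\<beta>\<in>UNIV.
             1/2 * (\<Sum>i\<in>UNIV. \<Sum>j\<in>UNIV.
               nabla_y A \<omega> b G s c x i \<alpha> * omega_tilde_inv A \<omega> G s c x $ i $ j
                 * nabla_y A \<omega> b G s c x j \<beta>)
               * wedge11 (f_star A G c x \<alpha>) (f_star A G c x \<beta>) v w)
          = (\<Sum>\<alpha>\<in>UNIV. \<Sum>\<beta>\<in>UNIV.
             nabla_q A \<omega> b G s c x \<beta> \<alpha>
               * wedge11 (f_star A G c x \<alpha>) (f_star A G c x \<beta>) v w)))"
proof -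
  interpret thickening_section A \<omega> b G U s
    using assms by unfold_locales (auto simp: lcps_manifold_def smooth_manifold_def)
  let ?D = "\<lambda>c x \<alpha> \<beta>. nabla_q A \<omega> b G s c x \<beta> \<alpha> - nabla_q A \<omega> b G s c x \<alpha> \<beta>"
  have strict: "(\<forall>\<alpha> \<beta>. nabla_pairing c x \<alpha> \<beta> = ?D c x \<alpha> \<beta>) \<longleftrightarrow> (\<forall>\<alpha> \<beta>. \<alpha> > \<beta> \<longrightarrow> nabla_pairing c x \<alpha> \<beta> = ?D c x \<alpha> \<beta>)"
    if "c \<in> FC" "x \<in> cdom c" for c x
  proof (intro iffI allI impI)
    fix \<alpha> \<beta> assume *: "\<forall>\<alpha> \<beta>. \<alpha> > \<beta> \<longrightarrow> nabla_pairing c x \<alpha> \<beta> = ?D c x \<alpha> \<beta>"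
    show "nabla_pairing c x \<alpha> \<beta> = ?D c x \<alpha> \<beta>"
      using *[rule_format, of \<beta> \<alpha>] *[rule_format, of \<alpha> \<beta>] nabla_pairing_skew[OF that, of \<alpha> \<beta>]
      by (cases \<alpha> \<beta> rule: linorder_cases) auto
  qed auto
  show ?thesis
    unfolding coisotropic_graph_iff[OF assms(4)] nabla_pairing_def[symmetric]
    by (intro conjI ball_cong refl strict wedge_equation_iff[symmetric])
qed

end
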